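(* Let $F$ be a finite forest and let $\mathcal{P}$ be a minimum caterpillar partition of $F$. Then \[\gamma_{gr}(F)=|V(F)|-|\mathcal{P}|,\] where $|\mathcal{P}|$ is the number of parts of $\mathcal{P}$.
   Context: For a graph $G$, a sequence of vertices $S=(v_1,\dots,v_k)$ is a legal sequence if for every $i\in[k]$, $N[v_i]\setminus\bigcup_{j=1}^{i-1}N[v_j]\neq\emptyset$ (here $N[v]$ is the closed neighborhood). The Grundy domination number $\gamma_{gr}(G)$ is the maximum length of a legal sequence of $G$. A caterpillar is a tree $C$ such that, for a maximum (longest) path $P$ of $C$, every vertex of $C$ is at distance at most $1$ from $P$. For a forest $F$, a minimum caterpillar partition of $F$ is a partition $\mathcal{P}=\{C_1,\dots,C_\ell\}$ of the set of non-isolated vertices of $F$ such that: (1) for every $i$, the subgraph of $F$ induced by $C_i$ is a caterpillar; (2) if for some $i\neq j$ there is an edge of $F$ between a vertex of $C_i$ and a vertex of $C_j$, then that edge is incident to a vertex which is a non-leaf vertex of the induced subgraph on $C_i$ or a non-leaf vertex of the induced subgraph on $C_j$; (3) among all partitions satisfying (1) and (2), $\mathcal{P}$ has the minimum number of parts. *)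

theory Defs
  imports "Graph_Theory.Graph_Theory" "HOL-Library.Disjoint_Sets"
begin

text \<open>
  A finite simple graph is a \<^locale>\<open>graph\<close>: a finite, symmetric, loop-free digraph without
  parallel arcs, where an undirected edge is a pair of opposite arcs.
\<close>

definition closed_nbhd :: "('a,'b) pre_digraph \<Rightarrow> 'a \<Rightarrow> 'a set" where
  "closed_nbhd G v = insert v {w. v \<rightarrow>\<^bsub>G\<^esub> w}"

definition legal_sequence :: "('a,'b) pre_digraph \<Rightarrow> 'a list \<Rightarrow> bool" where
  "legal_sequence G vs \<longleftrightarrow> set vs \<subseteq> verts G \<and>
    (\<forall>i<length vs. closed_nbhd G (vs ! i) - (\<Union>j<i. closed_nbhd G (vs ! j)) \<noteq> {})"

definition grundy_domination_number :: "('a,'b) pre_digraph \<Rightarrow> nat" where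
  "grundy_domination_number G = Max {length vs | vs. legal_sequence G vs}"

text \<open>
  The library predicates \<^const>\<open>forest\<close> and \<^const>\<open>tree\<close> are not usable here: in a symmetric
  digraph every edge already yields a \<open>cycle\<close> of length 2 in the sense of the library. In a
  \<^locale>\<open>graph\<close>, the cycles of the undirected graph are those of length at least 3.
\<close>

definition undirected_forest :: "('a,'b) pre_digraph \<Rightarrow> bool" where
  "undirected_forest G \<longleftrightarrow> graph G \<and> \<not> (\<exists>p. pre_digraph.cycle G p \<and> 3 \<le> length p)"

definition undirected_tree :: "('a,'b) pre_digraph \<Rightarrow> bool" where
  "undirected_tree G \<longleftrightarrow> connected G \<and> undirected_forest G"

definition longest_path :: "('a,'b) pre_digraph \<Rightarrow> 'a list \<Rightarrow> bool" where
  "longest_path G p \<longleftrightarrow> vpath p G \<and> (\<forall>q. vpath q G \<longrightarrow> vwalk_length q \<le> vwalk_length p)"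

definition graph_dist :: "('a,'b) pre_digraph \<Rightarrow> 'a \<Rightarrow> 'a \<Rightarrow> ereal" where
  "graph_dist G u v = wf_digraph.\<mu> G (\<lambda>_. 1) u v"

definition caterpillar :: "('a,'b) pre_digraph \<Rightarrow> bool" where
  "caterpillar G \<longleftrightarrow> undirected_tree G \<and>
    (\<exists>p. longest_path G p \<and> (\<forall>v\<in>verts G. \<exists>u\<in>set p. graph_dist G v u \<le> 1))"

definition non_isolated_verts :: "('a,'b) pre_digraph \<Rightarrow> 'a set" where
  "non_isolated_verts G = {v \<in> verts G. \<exists>w. v \<rightarrow>\<^bsub>G\<^esub> w}"

text \<open>
  In a \<^locale>\<open>graph\<close> the degree of a vertex is its \<^const>\<open>out_degree\<close>. A leaf is a vertex of
  degree 1, so the vertex of a one-vertex graph is not a leaf.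
\<close>

definition non_leaf :: "('a,'b) pre_digraph \<Rightarrow> 'a \<Rightarrow> bool" where
  "non_leaf G v \<longleftrightarrow> v \<in> verts G \<and> out_degree G v \<noteq> 1"

definition caterpillar_partition :: "('a,'b) pre_digraph \<Rightarrow> 'a set set \<Rightarrow> bool" where
  "caterpillar_partition F P \<longleftrightarrow>
    partition_on (non_isolated_verts F) P \<and>
    (\<forall>C\<in>P. caterpillar (F \<restriction> C)) \<and>
    (\<forall>C\<in>P. \<forall>D\<in>P. C \<noteq> D \<longrightarrow>
      (\<forall>u\<in>C. \<forall>v\<in>D. u \<rightarrow>\<^bsub>F\<^esub> v \<longrightarrow> non_leaf (F \<restriction> C) u \<or> non_leaf (F \<restriction> D) v))"

definition minimum_caterpillar_partition :: "('a,'b) pre_digraph \<Rightarrow> 'a set set \<Rightarrow> bool" where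
  "minimum_caterpillar_partition F P \<longleftrightarrow>
    caterpillar_partition F P \<and> (\<forall>Q. caterpillar_partition F Q \<longrightarrow> card P \<le> card Q)"

end

theory Submission
  imports Defs
begin

text \<open>
  Let the vertices \<open>S\<close> of a legal sequence be mapped by \<open>f\<close> to vertices they newly dominate. Whether
  a given \<open>S\<close> can be put into a legal order depends only on the acyclicity of the constraints
  imposed by \<open>f\<close>, and adding the edges of a forest one at a time shows that the constraints are
  acyclic as soon as \<open>f\<close> is injective and maps no edge onto itself.

  Given a partition into caterpillars, orient a dominating path in each of them, let each of its
  vertices but the last footprint its successor, and let all vertices outside the paths footprint
  themselves. An edge mapped onto itself would join two leaves of different parts.

  Conversely, the vertices that footprint themselves form an independent set \<open>I\<close>, and the arcs from
  the other vertices of \<open>S\<close> to their footprints form disjoint paths. Now join paths at their ends as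
  long as possible; the number of paths not inside \<open>I\<close> does not increase. Attaching the vertices of
  the paths inside \<open>I\<close> to adjacent paths gives caterpillars, and an edge between leaves of different
  parts would join the ends of two paths.
\<close>

section \<open>Simple paths of a relation\<close>

definition simple_path :: "('a \<times> 'a) set \<Rightarrow> 'a list \<Rightarrow> bool" where
  "simple_path E p \<longleftrightarrow> p \<noteq> [] \<and> distinct p \<and> set (vwalk_arcs p) \<subseteq> E"

lemma map_snd_vwalk_arcs: "map snd (vwalk_arcs p) = tl p"
  by (induction p rule: vwalk_arcs.induct) auto

lemma fst_set_vwalk_arcs: "fst ` set (vwalk_arcs p) = set (butlast p)"
  by (induction p rule: vwalk_arcs.induct) auto

lemma snd_set_vwalk_arcs: "snd ` set (vwalk_arcs p) = set (tl p)"
  by (metis map_snd_vwalk_arcs set_map)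

lemma simple_path_singleton: "simple_path E [x]"
  by (simp add: simple_path_def)

lemma simple_path_mono: "simple_path D p \<Longrightarrow> D \<subseteq> E \<Longrightarrow> simple_path E p"
  by (auto simp: simple_path_def)

lemma simple_path_append_iff:
  assumes "p \<noteq> []" "q \<noteq> []"
  shows "simple_path E (p @ q) \<longleftrightarrow>
    simple_path E p \<and> simple_path E q \<and> set p \<inter> set q = {} \<and> (last p, hd q) \<in> E"
  using assms by (auto simp: simple_path_def vwalk_arcs_append)

lemma simple_path_rev:
  assumes "sym E" "simple_path E p"
  shows "simple_path E (rev p)"
  using assms by (auto simp: simple_path_def set_vwalk_arcs_rev dest: symD)

lemma simple_path_butlast_Domain: "simple_path E p \<Longrightarrow> set (butlast p) \<subseteq> Domain E"
  unfolding simple_path_def fst_set_vwalk_arcs[symmetric] by force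

lemma simple_path_tl_Range: "simple_path E p \<Longrightarrow> set (tl p) \<subseteq> Range E"
  unfolding simple_path_def snd_set_vwalk_arcs[symmetric] by force

lemma vwalk_arcs_rtrancl:
  assumes "set (vwalk_arcs p) \<subseteq> E" "x \<in> set p"
  shows "(hd p, x) \<in> E\<^sup>*"
  using assms
proof (induction p rule: vwalk_arcs.induct)
  case (3 y z p)
  show ?case
  proof (cases "x = y")
    case False
    with 3 have "(y, z) \<in> E" "(z, x) \<in> E\<^sup>*" by auto
    then show ?thesis by (simp add: converse_rtrancl_into_rtrancl)
  qed simp
qed auto

lemma vwalk_arcs_sym_rtrancl:
  assumes "sym E" "set (vwalk_arcs p) \<subseteq> E" "x \<in> set p" "y \<in> set p"
  shows "(x, y) \<in> E\<^sup>*"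
  using vwalk_arcs_rtrancl[OF assms(2)] sym_rtrancl[OF assms(1)] assms(3,4)
  by (meson rtrancl_trans symD)

lemma rtrancl_imp_simple_path:
  assumes "(x, y) \<in> E\<^sup>*"
  obtains p where "simple_path E p" "hd p = x" "last p = y"
proof -
  from assms have "\<exists>p. simple_path E p \<and> hd p = x \<and> last p = y"
  proof (induction rule: converse_rtrancl_induct)
    case base
    show ?case by (rule exI[of _ "[y]"]) (simp add: simple_path_singleton)
  next
    case (step x z)
    then obtain p where p: "simple_path E p" "hd p = z" "last p = y" by blast
    then have ne: "p \<noteq> []" by (simp add: simple_path_def)
    show ?case
    proof (cases "x \<in> set p")
      case False
      with p ne step.hyps(1) show ?thesis
        by (intro exI[of _ "x # p"]) (auto simp: simple_path_def)
    next
      case True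
      then obtain p1 p2 where "p = p1 @ x # p2" by (meson split_list)
      with p have "simple_path E (x # p2)" "last (x # p2) = y"
        using simple_path_append_iff[of p1 "x # p2" E] by (cases "p1 = []"; simp)+
      then show ?thesis by (intro exI[of _ "x # p2"]) simp
    qed
  qed
  with that show thesis by blast
qed

section \<open>Path covers\<close>

definition path_cover :: "('a \<times> 'a) set \<Rightarrow> 'a set \<Rightarrow> 'a list set \<Rightarrow> bool" where
  "path_cover E W \<P> \<longleftrightarrow>
    (\<forall>p\<in>\<P>. simple_path E p) \<and> disjoint_family_on set \<P> \<and> (\<Union>p\<in>\<P>. set p) = W"

lemma
  assumes "path_cover E W \<P>"
  shows path_cover_simple_path: "p \<in> \<P> \<Longrightarrow> simple_path E p"
    and path_cover_nonempty: "p \<in> \<P> \<Longrightarrow> p \<noteq> []"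
    and path_cover_eq: "p \<in> \<P> \<Longrightarrow> q \<in> \<P> \<Longrightarrow> x \<in> set p \<Longrightarrow> x \<in> set q \<Longrightarrow> p = q"
    and path_cover_Union: "(\<Union>p\<in>\<P>. set p) = W"
  using assms by (auto simp: path_cover_def simple_path_def disjoint_family_on_def)

lemma path_cover_mono: "path_cover D W \<P> \<Longrightarrow> D \<subseteq> E \<Longrightarrow> path_cover E W \<P>"
  using simple_path_mono by (fastforce simp: path_cover_def)

lemma path_cover_singletons: "path_cover E W ((\<lambda>x. [x]) ` W)"
  by (auto simp: path_cover_def disjoint_family_on_def simple_path_singleton)

lemma finite_path_cover:
  assumes "path_cover E W \<P>" "finite W"
  shows "finite \<P>"
proof (rule inj_on_finite)
  show "inj_on set \<P>"
  proof (rule inj_onI)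
    fix p q assume "p \<in> \<P>" "q \<in> \<P>" "set p = set q"
    then show "p = q"
      using path_cover_eq[OF assms(1)] path_cover_nonempty[OF assms(1)] hd_in_set by metis
  qed
  show "set ` \<P> \<subseteq> Pow W" using path_cover_Union[OF assms(1)] by auto
qed (use assms(2) in simp)

lemma path_cover_join:
  assumes cover: "path_cover E W \<P>" and "finite W" and pq: "p \<in> \<P>" "q \<in> \<P>" "p \<noteq> q"
    and r: "simple_path E r" "set r = set p \<union> set q"
  shows "path_cover E W (insert r (\<P> - {p, q}))"
    and "Suc (card (insert r (\<P> - {p, q}))) = card \<P>"
proof -
  have disj: "set r \<inter> set s = {}" if "s \<in> \<P> - {p, q}" for s
    using that path_cover_eq[OF cover] pq r(2) by blast
  then have "r \<notin> \<P> - {p, q}" using r(1) by (metis inf.idem set_empty simple_path_def)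
  moreover have "finite \<P>" using finite_path_cover cover \<open>finite W\<close> by blast
  ultimately show "Suc (card (insert r (\<P> - {p, q}))) = card \<P>"
    using pq card_mono[of \<P> "{p, q}"] by (simp add: card_Diff_subset)
  have "disjoint_family_on set (insert r (\<P> - {p, q}))"
    unfolding disjoint_family_on_def
  proof (intro ballI impI)
    fix s t assume "s \<in> insert r (\<P> - {p, q})" "t \<in> insert r (\<P> - {p, q})" "s \<noteq> t"
    then show "set s \<inter> set t = {}"
      using disj[of s] disj[of t] path_cover_eq[OF cover, of s t] by blast
  qed
  moreover have "(\<Union>p\<in>insert r (\<P> - {p, q}). set p) = W"
    using path_cover_Union[OF cover] pq r(2) by auto
  ultimately show "path_cover E W (insert r (\<P> - {p, q}))"
    using r(1) path_cover_simple_path[OF cover] by (simp add: path_cover_def)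
qed

lemma path_cover_insert_arc:
  assumes cover: "path_cover A W \<P>" and W: "finite W" "x \<in> W" "y \<in> W"
    and ends: "x \<notin> Domain A" "y \<notin> Range A" and no_cycle: "(y, x) \<notin> A\<^sup>*"
  obtains \<Q> where "path_cover (insert (x, y) A) W \<Q>" "Suc (card \<Q>) = card \<P>"
proof -
  obtain p q where p: "p \<in> \<P>" "x \<in> set p" and q: "q \<in> \<P>" "y \<in> set q"
    using path_cover_Union[OF cover] W(2,3) by blast
  note paths = path_cover_simple_path[OF cover p(1)] path_cover_simple_path[OF cover q(1)]
  have ne: "p \<noteq> []" "q \<noteq> []" using paths by (simp_all add: simple_path_def)
  have "x \<notin> set (butlast p)" using simple_path_butlast_Domain[OF paths(1)] ends(1) by blast
  then have x: "last p = x" using p(2) by (cases p rule: rev_cases) auto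
  have "y \<notin> set (tl q)" using simple_path_tl_Range[OF paths(2)] ends(2) by blast
  then have y: "hd q = y" using q(2) by (cases q) auto
  have "p \<noteq> q"
    using vwalk_arcs_rtrancl[of p A x] p(2) paths(1) y no_cycle by (auto simp: simple_path_def)
  then have "set p \<inter> set q = {}" using path_cover_eq[OF cover p(1) q(1)] by blast
  then have "simple_path (insert (x, y) A) (p @ q)"
    using paths ne x y by (auto simp: simple_path_append_iff intro: simple_path_mono)
  moreover have "path_cover (insert (x, y) A) W \<P>" using path_cover_mono[OF cover] by blast
  ultimately show thesis
    using path_cover_join[OF _ W(1) p(1) q(1) \<open>p \<noteq> q\<close> _ set_append] that by blast
qed

lemma acyclic_linear_imp_path_cover:
  assumes "finite W" "A \<subseteq> W \<times> W" "acyclic A" "single_valued A" "single_valued (A\<inverse>)"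
  obtains \<P> where "path_cover A W \<P>" "card \<P> + card A = card W"
proof -
  have "finite A" using assms(1,2) by (meson finite_SigmaI finite_subset)
  then have "\<exists>\<P>. path_cover A W \<P> \<and> card \<P> + card A = card W"
    using assms(2-)
  proof (induction A)
    case empty
    have "card ((\<lambda>x. [x]) ` W) = card W" by (simp add: card_image inj_on_def)
    then show ?case using path_cover_singletons[of "{}" W] by auto
  next
    case (insert e A)
    obtain x y where e: "e = (x, y)" by fastforce
    have acyc: "acyclic A" "(y, x) \<notin> A\<^sup>*" using insert.prems(2) by (simp_all add: e acyclic_insert)
    have ends: "x \<notin> Domain A" "y \<notin> Range A"
      using single_valuedD[OF insert.prems(3), of x y] single_valuedD[OF insert.prems(4), of y x]
        insert.hyps(2) by (auto simp: e)
    have "single_valued A" "single_valued (A\<inverse>)"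
      using insert.prems(3,4) by (auto intro: single_valued_subset[rotated])
    then obtain \<P> where \<P>: "path_cover A W \<P>" "card \<P> + card A = card W"
      using insert.IH insert.prems(1) acyc(1) by auto
    obtain \<Q> where "path_cover (insert e A) W \<Q>" "Suc (card \<Q>) = card \<P>"
      using path_cover_insert_arc[OF \<P>(1) assms(1) _ _ ends acyc(2)] insert.prems(1) e by auto
    with \<P>(2) insert.hyps show ?case by auto
  qed
  with that show thesis by blast
qed

lemma
  assumes "distinct p"
  shows vwalk_arcs_left_unique:
      "(x, z) \<in> set (vwalk_arcs p) \<Longrightarrow> (y, z) \<in> set (vwalk_arcs p) \<Longrightarrow> x = y"
    and vwalk_arcs_asym: "(x, y) \<in> set (vwalk_arcs p) \<Longrightarrow> (y, x) \<notin> set (vwalk_arcs p)"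
proof -
  have "distinct (map snd (vwalk_arcs p))"
    using assms by (simp add: map_snd_vwalk_arcs distinct_tl)
  then have "inj_on snd (set (vwalk_arcs p))" by (simp add: distinct_map)
  then show "(x, z) \<in> set (vwalk_arcs p) \<Longrightarrow> (y, z) \<in> set (vwalk_arcs p) \<Longrightarrow> x = y"
    using inj_onD[of snd _ "(x, z)" "(y, z)"] by simp
  show "(x, y) \<in> set (vwalk_arcs p) \<Longrightarrow> (y, x) \<notin> set (vwalk_arcs p)"
    using assms by (induction p rule: vwalk_arcs.induct) (auto dest: arcs_in_vwalk_arcs)
qed

definition path_arcs :: "'a list set \<Rightarrow> ('a \<times> 'a) set" where
  "path_arcs \<P> = (\<Union>p\<in>\<P>. set (vwalk_arcs p))"

lemma Domain_path_arcs:
  assumes cover: "path_cover E W \<P>"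
  shows "Domain (path_arcs \<P>) = W - last ` \<P>"
proof -
  have "Domain (path_arcs \<P>) = (\<Union>p\<in>\<P>. set (butlast p))"
    by (simp add: path_arcs_def Domain_fst image_UN fst_set_vwalk_arcs)
  also have "\<dots> = (\<Union>p\<in>\<P>. set p - {last p})"
  proof (rule SUP_cong)
    fix p assume "p \<in> \<P>"
    then have "p \<noteq> []" "distinct p"
      using path_cover_simple_path[OF cover] by (auto simp: simple_path_def)
    then show "set (butlast p) = set p - {last p}" by (cases p rule: rev_cases) auto
  qed simp
  also have "\<dots> = W - last ` \<P>"
  proof -
    have "x \<in> last ` \<P> \<longleftrightarrow> x = last p" if "p \<in> \<P>" "x \<in> set p" for x p
      using path_cover_eq[OF cover that(1) _ that(2)] path_cover_nonempty[OF cover] that(1) by auto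
    then show ?thesis by (auto simp flip: path_cover_Union[OF cover])
  qed
  finally show ?thesis .
qed

lemma
  assumes cover: "path_cover E W \<P>"
  shows path_arcs_subset: "path_arcs \<P> \<subseteq> E \<inter> W \<times> W"
    and path_arcs_left_unique: "(x, z) \<in> path_arcs \<P> \<Longrightarrow> (y, z) \<in> path_arcs \<P> \<Longrightarrow> x = y"
    and path_arcs_asym: "(x, y) \<in> path_arcs \<P> \<Longrightarrow> (y, x) \<notin> path_arcs \<P>"
proof -
  have path: "distinct p" "set (vwalk_arcs p) \<subseteq> E" "set p \<subseteq> W" if "p \<in> \<P>" for p
    using that path_cover_simple_path[OF cover that] path_cover_Union[OF cover]
    by (auto simp: simple_path_def)
  then show "path_arcs \<P> \<subseteq> E \<inter> W \<times> W"
    by (fastforce simp: path_arcs_def dest: arcs_in_vwalk_arcs)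
  have common_path: "\<exists>p\<in>\<P>. (x, y) \<in> set (vwalk_arcs p) \<and> (x', y') \<in> set (vwalk_arcs p)"
    if arcs: "(x, y) \<in> path_arcs \<P>" "(x', y') \<in> path_arcs \<P>" and common: "y \<in> {x', y'}"
    for x y x' y'
  proof -
    obtain p q where p: "p \<in> \<P>" "(x, y) \<in> set (vwalk_arcs p)"
      and q: "q \<in> \<P>" "(x', y') \<in> set (vwalk_arcs q)"
      using arcs by (auto simp: path_arcs_def)
    then have "p = q"
      using path_cover_eq[OF cover, of p q y] common by (auto dest!: arcs_in_vwalk_arcs)
    with p q show ?thesis by blast
  qed
  show "(x, z) \<in> path_arcs \<P> \<Longrightarrow> (y, z) \<in> path_arcs \<P> \<Longrightarrow> x = y"
    using common_path[of x z y z] path(1) by (auto dest: vwalk_arcs_left_unique)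
  show "(x, y) \<in> path_arcs \<P> \<Longrightarrow> (y, x) \<notin> path_arcs \<P>"
    using common_path[of x y y x] path(1) by (auto dest: vwalk_arcs_asym)
qed

lemma path_cover_imp_successor:
  assumes cover: "path_cover E W \<P>"
  obtains f where
    "\<And>x. f x \<noteq> x \<longleftrightarrow> x \<in> W - last ` \<P>"
    "\<And>x. f x \<noteq> x \<Longrightarrow> (x, f x) \<in> E"
    "inj_on f (- last ` \<P>)"
    "\<And>x. f x \<noteq> x \<Longrightarrow> f (f x) \<noteq> x"
proof -
  note asym = path_arcs_asym[OF cover] and subset = path_arcs_subset[OF cover]
  have "\<forall>x\<in>W - last ` \<P>. \<exists>y. (x, y) \<in> path_arcs \<P>"
    using Domain_path_arcs[OF cover] by blast
  then obtain g where g: "\<And>x. x \<in> W - last ` \<P> \<Longrightarrow> (x, g x) \<in> path_arcs \<P>" by metis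
  define f where "f x = (if x \<in> W - last ` \<P> then g x else x)" for x
  have moved: "f x \<noteq> x \<longleftrightarrow> x \<in> W - last ` \<P>" for x
    using g[of x] asym[of x x] by (auto simp: f_def)
  then have arc: "(x, f x) \<in> path_arcs \<P>" if "f x \<noteq> x" for x
    using that g[of x] by (auto simp: f_def)
  show thesis
  proof (rule that[OF moved])
    show "(x, f x) \<in> E" if "f x \<noteq> x" for x using arc[OF that] subset by blast
    show "f (f x) \<noteq> x" if "f x \<noteq> x" for x using arc[of x] arc[of "f x"] asym that by metis
    have fixed: "f y \<noteq> y" if "f x \<noteq> x" "f x = f y" "y \<notin> last ` \<P>" for x y
      using that arc[of x] subset moved[of y] by auto
    show "inj_on f (- last ` \<P>)"
    proof (rule inj_onI)
      fix x y assume "x \<in> - last ` \<P>" "y \<in> - last ` \<P>" "f x = f y"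
      then show "x = y"
        using fixed[of x y] fixed[of y x] arc[of x] arc[of y] path_arcs_left_unique[OF cover]
        by (metis ComplD)
    qed
  qed
qed

section \<open>Acyclic relations\<close>

lemma acyclic_Un_relcomp:
  assumes "acyclic r" and once: "s O r\<^sup>* O s = {}"
  shows "acyclic (r \<union> s)"
proof -
  have "(x, y) \<in> r\<^sup>+ \<union> r\<^sup>* O s O r\<^sup>*" if "(x, y) \<in> (r \<union> s)\<^sup>+" for x y
    using that
  proof (induction rule: trancl_induct)
    case (base y)
    then show ?case by blast
  next
    case (step y z)
    then consider "(x, y) \<in> r\<^sup>+" | "(x, y) \<in> r\<^sup>* O s O r\<^sup>*" by blast
    then show ?case
    proof cases
      case 1
      with step.hyps(2) show ?thesis
        by (blast intro: trancl_into_trancl trancl_into_rtrancl)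
    next
      case 2
      then obtain a b where ab: "(x, a) \<in> r\<^sup>*" "(a, b) \<in> s" "(b, y) \<in> r\<^sup>*" by blast
      with once have "(y, z) \<notin> s" by blast
      with step.hyps(2) ab show ?thesis by (blast intro: rtrancl_into_rtrancl)
    qed
  qed
  moreover have "(x, x) \<notin> r\<^sup>* O s O r\<^sup>*" for x
  proof
    assume "(x, x) \<in> r\<^sup>* O s O r\<^sup>*"
    then obtain a b where "(a, b) \<in> s" "(b, a) \<in> r\<^sup>*" by (blast intro: rtrancl_trans)
    with once show False by blast
  qed
  ultimately show ?thesis using assms(1) unfolding acyclic_def by blast
qed

lemma finite_acyclic_imp_sorted_wrt:
  assumes "finite S" "acyclic R"
  obtains vs where "distinct vs" "set vs = S" "sorted_wrt (\<lambda>x y. (y, x) \<notin> R) vs"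
proof -
  define rank where "rank x = card {y \<in> S. (y, x) \<in> R\<^sup>+}" for x
  have rank: "rank y < rank x" if "(y, x) \<in> R" "y \<in> S" for x y
    unfolding rank_def
  proof (rule psubset_card_mono)
    show "{z \<in> S. (z, y) \<in> R\<^sup>+} \<subset> {z \<in> S. (z, x) \<in> R\<^sup>+}"
      using that assms(2) by (auto simp: acyclic_def intro: trancl_into_trancl)
  qed (use assms(1) in simp)
  obtain xs where xs: "set xs = S" "distinct xs" using finite_distinct_list[OF assms(1)] by blast
  show thesis
  proof (rule that)
    have "sorted_wrt (\<lambda>x y. rank x \<le> rank y) (sort_key rank xs)"
      using sorted_sort_key[of rank xs] by (simp add: sorted_map)
    then show "sorted_wrt (\<lambda>x y. (y, x) \<notin> R) (sort_key rank xs)"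
      by (rule sorted_wrt_mono_rel[rotated]) (use rank xs(1) in fastforce)
  qed (use xs in simp_all)
qed

section \<open>Footprints and legal sequences\<close>

definition cnbhd :: "('a \<times> 'a) set \<Rightarrow> 'a \<Rightarrow> 'a set" where
  "cnbhd E v = insert v (E `` {v})"

text \<open>If every \<open>w \<in> S\<close> is to footprint \<open>f w\<close>, a pair \<open>(w, v)\<close> forces \<open>w\<close> to come before \<open>v\<close>. The
  condition \<open>f w \<in> cnbhd E w\<close> makes the relation grow with \<open>E\<close> from the empty one, so that it can
  be studied by adding the edges one at a time.\<close>

definition precedence :: "('a \<times> 'a) set \<Rightarrow> 'a set \<Rightarrow> ('a \<Rightarrow> 'a) \<Rightarrow> ('a \<times> 'a) set" where
  "precedence E S f = {(w, v). w \<in> S \<and> w \<noteq> v \<and> f w \<in> cnbhd E w \<inter> cnbhd E v}"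

definition footprint_map :: "('a \<times> 'a) set \<Rightarrow> 'a set \<Rightarrow> ('a \<Rightarrow> 'a) \<Rightarrow> bool" where
  "footprint_map E S f \<longleftrightarrow> (\<forall>v\<in>S. f v \<in> cnbhd E v) \<and> acyclic (precedence E S f)"

lemma mem_cnbhd_iff: "w \<in> cnbhd E v \<longleftrightarrow> w = v \<or> (v, w) \<in> E"
  by (auto simp: cnbhd_def)

lemma footprint_map_asym:
  assumes "footprint_map E S f" "(v, w) \<in> precedence E S f"
  shows "(w, v) \<notin> precedence E S f"
proof
  assume "(w, v) \<in> precedence E S f"
  with assms(2) have "(v, v) \<in> (precedence E S f)\<^sup>+" by (meson trancl.simps)
  with assms(1) show False by (simp add: footprint_map_def acyclic_def)
qed

lemma footprint_map_inj_on:
  assumes "footprint_map E S f"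
  shows "inj_on f S"
proof (rule inj_onI, rule ccontr)
  fix v w assume "v \<in> S" "w \<in> S" "f v = f w" "v \<noteq> w"
  then have "(v, w) \<in> precedence E S f" "(w, v) \<in> precedence E S f"
    using assms by (auto simp: footprint_map_def precedence_def)
  with footprint_map_asym[OF assms] show False by blast
qed

lemma footprint_map_fixed_not_adjacent:
  assumes "footprint_map E S f" "sym E" "v \<in> S" "f v = v" "w \<in> S" "f w = w" "v \<noteq> w"
  shows "(v, w) \<notin> E"
proof
  assume "(v, w) \<in> E"
  then have "(v, w) \<in> precedence E S f" "(w, v) \<in> precedence E S f"
    using assms(3-) symD[OF assms(2)] by (auto simp: precedence_def mem_cnbhd_iff)
  with footprint_map_asym[OF assms(1)] show False by blast
qed

lemma sorted_wrt_imp_acyclic_precedence: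
  assumes "\<forall>v\<in>set vs. f v \<in> cnbhd E v" "sorted_wrt (\<lambda>w v. f v \<notin> cnbhd E w) vs"
  shows "acyclic (precedence E (set vs) f)"
  using assms
proof (induction vs)
  case (Cons x vs)
  let ?out = "{x} \<times> (UNIV - {x})"
  have no_in: "(v, x) \<notin> precedence E (set vs) f" for v
    using Cons.prems(2) by (auto simp: precedence_def)
  have "(v, x) \<in> (precedence E (set vs) f)\<^sup>* \<Longrightarrow> v = x" for v
    using no_in by (auto elim: rtranclE)
  then have "acyclic (precedence E (set vs) f \<union> ?out)"
    using Cons by (intro acyclic_Un_relcomp) auto
  then show ?case
    by (rule acyclic_subset) (auto simp: precedence_def)
qed (simp add: precedence_def acyclic_def)

lemma closed_nbhd_eq_cnbhd: "closed_nbhd G = cnbhd (arcs_ends G)"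
  by (auto simp: closed_nbhd_def cnbhd_def fun_eq_iff)

lemma legal_sequence_iff_sorted_wrt:
  "legal_sequence G vs \<longleftrightarrow> set vs \<subseteq> verts G \<and>
    (\<exists>f. (\<forall>v\<in>set vs. f v \<in> cnbhd (arcs_ends G) v) \<and>
      sorted_wrt (\<lambda>w v. f v \<notin> cnbhd (arcs_ends G) w) vs)"
proof -
  let ?N = "cnbhd (arcs_ends G)"
  have "(\<forall>i<length vs. ?N (vs ! i) - (\<Union>j<i. ?N (vs ! j)) \<noteq> {}) \<longleftrightarrow>
      (\<exists>f. (\<forall>v\<in>set vs. f v \<in> ?N v) \<and> sorted_wrt (\<lambda>w v. f v \<notin> ?N w) vs)" (is "?L \<longleftrightarrow> ?R")
  proof
    assume ?L
    then have "\<exists>g. \<forall>i\<in>{..<length vs}. g i \<in> ?N (vs ! i) - (\<Union>j<i. ?N (vs ! j))"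
      by (intro bchoice) blast
    then obtain g where g: "\<And>i. i < length vs \<Longrightarrow> g i \<in> ?N (vs ! i) - (\<Union>j<i. ?N (vs ! j))"
      by (metis lessThan_iff)
    have "vs ! i \<noteq> vs ! j" if "i < length vs" "j < i" for i j using g[OF that(1)] that(2) by auto
    then have "distinct vs" unfolding distinct_conv_nth by (metis nat_neq_iff)
    then have inj: "inj_on ((!) vs) {..<length vs}" by (rule inj_on_nth) simp
    define f where "f = g \<circ> inv_into {..<length vs} ((!) vs)"
    have f: "f (vs ! i) = g i" if "i < length vs" for i
      using inv_into_f_f[OF inj] that by (simp add: f_def)
    have "\<forall>v\<in>set vs. f v \<in> ?N v" using f g by (metis DiffD1 in_set_conv_nth)
    moreover have "sorted_wrt (\<lambda>w v. f v \<notin> ?N w) vs"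
      using f g by (simp add: sorted_wrt_iff_nth_less)
    ultimately show ?R by blast
  next
    assume ?R
    then obtain f where f: "\<forall>v\<in>set vs. f v \<in> ?N v" "sorted_wrt (\<lambda>w v. f v \<notin> ?N w) vs" by blast
    show ?L
    proof (intro allI impI)
      fix i assume "i < length vs"
      then have "f (vs ! i) \<in> ?N (vs ! i) - (\<Union>j<i. ?N (vs ! j))"
        using f(1) sorted_wrt_nth_less[OF f(2)] by simp
      then show "?N (vs ! i) - (\<Union>j<i. ?N (vs ! j)) \<noteq> {}" by blast
    qed
  qed
  then show ?thesis by (simp add: legal_sequence_def closed_nbhd_eq_cnbhd)
qed

lemma legal_sequence_imp_footprint_map:
  assumes "legal_sequence G vs"
  obtains f where "footprint_map (arcs_ends G) (set vs) f" "distinct vs"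
proof -
  obtain f where f: "\<forall>v\<in>set vs. f v \<in> cnbhd (arcs_ends G) v"
    and sorted: "sorted_wrt (\<lambda>w v. f v \<notin> cnbhd (arcs_ends G) w) vs"
    using assms by (auto simp: legal_sequence_iff_sorted_wrt)
  have "sorted_wrt (\<noteq>) vs"
    using sorted by (rule sorted_wrt_mono_rel[rotated]) (use f in auto)
  then have "distinct vs" by (induction vs) auto
  moreover have "footprint_map (arcs_ends G) (set vs) f"
    using f sorted_wrt_imp_acyclic_precedence[OF f sorted] by (simp add: footprint_map_def)
  ultimately show thesis using that by blast
qed

lemma footprint_map_imp_legal_sequence:
  assumes "finite S" "S \<subseteq> verts G" and f: "footprint_map (arcs_ends G) S f"
  obtains vs where "legal_sequence G vs" "length vs = card S"
proof -
  have "acyclic (precedence (arcs_ends G) S f)" using f by (simp add: footprint_map_def)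
  then obtain vs where vs: "distinct vs" "set vs = S"
    "sorted_wrt (\<lambda>w v. (v, w) \<notin> precedence (arcs_ends G) S f) vs"
    using finite_acyclic_imp_sorted_wrt[OF assms(1)] by blast
  have "sorted_wrt (\<lambda>w v. f v \<notin> cnbhd (arcs_ends G) w) vs"
    unfolding sorted_wrt_iff_nth_less
  proof (intro allI impI)
    fix i j assume ij: "i < j" "j < length vs"
    then have "vs ! j \<noteq> vs ! i" "vs ! j \<in> S" using vs(1,2) by (auto simp: nth_eq_iff_index_eq)
    moreover have "(vs ! j, vs ! i) \<notin> precedence (arcs_ends G) S f"
      using sorted_wrt_nth_less[OF vs(3) ij] .
    ultimately show "f (vs ! j) \<notin> cnbhd (arcs_ends G) (vs ! i)"
      using f by (auto simp: precedence_def footprint_map_def)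
  qed
  then have "legal_sequence G vs"
    using vs(2) f assms(2) by (auto simp: legal_sequence_iff_sorted_wrt footprint_map_def)
  then show thesis using that vs(1,2) distinct_card by metis
qed

section \<open>Joining two components by an edge\<close>

lemma precedence_rtrancl_subset:
  assumes "sym D"
  shows "(precedence D S f)\<^sup>* \<subseteq> D\<^sup>*"
proof (intro rtrancl_subset_rtrancl subrelI)
  fix w v assume "(w, v) \<in> precedence D S f"
  then have "(w, f w) \<in> D\<^sup>*" "(f w, v) \<in> D\<^sup>*"
    using symD[OF assms] by (auto simp: precedence_def mem_cnbhd_iff)
  then show "(w, v) \<in> D\<^sup>*" by (rule rtrancl_trans)
qed

text \<open>The pairs of the precedence relation that appear when an edge \<open>{a, b}\<close> is added to \<open>D\<close> and
  that lead from the component of \<open>a\<close> to the component of \<open>b\<close>.\<close>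

definition crossing :: "('a \<times> 'a) set \<Rightarrow> 'a set \<Rightarrow> ('a \<Rightarrow> 'a) \<Rightarrow> 'a \<Rightarrow> 'a \<Rightarrow> ('a \<times> 'a) set" where
  "crossing D S f a b = {(w, v). w \<in> S \<and>
    (f w = a \<and> w \<in> cnbhd D a \<and> v = b \<or> w = a \<and> f w = b \<and> v \<in> cnbhd D b)}"

lemma precedence_insert_edge_subset:
  assumes "sym D"
  shows "precedence (D \<union> {(a, b), (b, a)}) S f \<subseteq>
    precedence D S f \<union> (crossing D S f a b \<union> crossing D S f b a)"
proof (rule subrelI)
  let ?D = "D \<union> {(a, b), (b, a)}"
  have D_sym: "x \<in> cnbhd D y \<longleftrightarrow> y \<in> cnbhd D x" for x y
    using symD[OF assms] by (auto simp: mem_cnbhd_iff)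
  fix w v assume "(w, v) \<in> precedence ?D S f"
  then have wv: "w \<in> S" "w \<noteq> v" "f w \<in> cnbhd ?D w" "f w \<in> cnbhd ?D v"
    by (simp_all add: precedence_def)
  then consider "f w \<in> cnbhd D w" "f w \<in> cnbhd D v"
    | "f w \<in> cnbhd D w" "v = a \<and> f w = b \<or> v = b \<and> f w = a"
    | "w = a \<and> f w = b \<or> w = b \<and> f w = a" "f w \<in> cnbhd D v"
    unfolding mem_cnbhd_iff by blast
  then show "(w, v) \<in> precedence D S f \<union> (crossing D S f a b \<union> crossing D S f b a)"
  proof cases
    case 1
    with wv(1,2) show ?thesis by (simp add: precedence_def)
  next
    case 2
    with wv(1) D_sym[of "f w" w] show ?thesis by (auto simp: crossing_def)
  next
    case 3
    with wv(1) D_sym[of "f w" v] show ?thesis by (auto simp: crossing_def)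
  qed
qed

lemma crossing_rtrancl:
  assumes "sym D" "(w, v) \<in> crossing D S f a b"
  shows "(w, a) \<in> D\<^sup>*" "(b, v) \<in> D\<^sup>*"
  using assms(2) symD[OF assms(1)] by (auto simp: crossing_def mem_cnbhd_iff)

lemma acyclic_precedence_crossing:
  assumes "sym D" "acyclic (precedence D S f)" "(b, a) \<notin> D\<^sup>*"
  shows "acyclic (precedence D S f \<union> crossing D S f a b)"
proof (rule acyclic_Un_relcomp[OF assms(2)])
  have "(v, w) \<notin> (precedence D S f)\<^sup>*"
    if "(x, v) \<in> crossing D S f a b" "(w, y) \<in> crossing D S f a b" for x v w y
  proof
    assume "(v, w) \<in> (precedence D S f)\<^sup>*"
    then have "(v, w) \<in> D\<^sup>*"
      using precedence_rtrancl_subset[OF assms(1)] by blast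
    with crossing_rtrancl[OF assms(1)] that have "(b, a) \<in> D\<^sup>*" by (meson rtrancl_trans)
    with assms(3) show False ..
  qed
  then show "crossing D S f a b O (precedence D S f)\<^sup>* O crossing D S f a b = {}" by blast
qed

lemma opposite_crossing_footprint:
  assumes "sym D" "(a, b) \<notin> D\<^sup>*" and inj: "inj_on f S"
    and not_fixed: "a \<in> S \<Longrightarrow> b \<in> S \<Longrightarrow> f ` {a, b} \<noteq> {a, b}"
    and w: "(w, v) \<in> crossing D S f a b" and w': "(w', v') \<in> crossing D S f b a"
  shows "f w = a \<and> v = b"
proof -
  have S: "w \<in> S" "w' \<in> S" using w w' by (auto simp: crossing_def)
  have "\<not> (w = a \<and> f w = b)"
  proof
    assume wa: "w = a \<and> f w = b"
    have "f w' \<noteq> b"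
    proof
      assume "f w' = b"
      then have "w' = a" using inj_onD[OF inj] wa S by metis
      then show False using crossing_rtrancl(1)[OF assms(1) w'] assms(2) by blast
    qed
    then have "w' = b" "f b = a" using w' by (auto simp: crossing_def)
    then show False using not_fixed wa S by auto
  qed
  then show ?thesis using w by (auto simp: crossing_def)
qed

lemma acyclic_precedence_insert_opposite:
  assumes "sym D" and acyc: "acyclic (precedence D S f)"
    and sep: "(a, b) \<notin> D\<^sup>*" "(b, a) \<notin> D\<^sup>*"
    and w: "w \<in> S" "f w = a" "w \<in> cnbhd D a" and w': "w' \<in> S" "f w' = b" "w' \<in> cnbhd D b"
    and not_fixed: "w \<noteq> a \<or> w' \<noteq> b"
  shows "acyclic (insert (w', a) (insert (w, b) (precedence D S f)))"
proof -
  let ?c = "precedence D S f"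
  note path = subsetD[OF precedence_rtrancl_subset[OF assms(1)]]
  have wD: "(w, a) \<in> D\<^sup>*" "(w', b) \<in> D\<^sup>*"
    using w(3) w'(3) symD[OF assms(1)] by (auto simp: mem_cnbhd_iff)
  have step: "(z, f z) \<in> ?c" if "z \<in> S" "z \<in> cnbhd D (f z)" "z \<noteq> f z" for z
    using that symD[OF assms(1)] by (auto simp: precedence_def mem_cnbhd_iff)
  have fixed: "z = f z" if "z \<in> S" "z \<in> cnbhd D (f z)" "(f z, z) \<in> ?c\<^sup>*" for z
  proof (rule ccontr)
    assume "z \<noteq> f z"
    with step that have "(f z, f z) \<in> ?c\<^sup>+" by (meson rtrancl_into_trancl1)
    with acyc show False by (simp add: acyclic_def)
  qed
  have "(b, w) \<notin> ?c\<^sup>*" "(a, w') \<notin> ?c\<^sup>*"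
    using path wD sep by (meson rtrancl_trans)+
  moreover have "\<not> ((a, w) \<in> ?c\<^sup>* \<and> (b, w') \<in> ?c\<^sup>*)"
    using fixed[of w] fixed[of w'] w w' not_fixed by auto
  ultimately show ?thesis
    using acyc by (simp add: acyclic_insert rtrancl_insert)
qed

lemma acyclic_precedence_insert_edge:
  assumes "sym D" "(a, b) \<notin> D\<^sup>*" and acyc: "acyclic (precedence D S f)"
    and inj: "inj_on f S" and not_fixed: "a \<in> S \<Longrightarrow> b \<in> S \<Longrightarrow> f ` {a, b} \<noteq> {a, b}"
  shows "acyclic (precedence (D \<union> {(a, b), (b, a)}) S f)"
proof -
  let ?c = "precedence D S f" and ?ab = "crossing D S f a b" and ?ba = "crossing D S f b a"
  have sep: "(b, a) \<notin> D\<^sup>*" using assms(2) symD[OF sym_rtrancl[OF assms(1)]] by blast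
  have subset: "precedence (D \<union> {(a, b), (b, a)}) S f \<subseteq> ?c \<union> (?ab \<union> ?ba)"
    using precedence_insert_edge_subset[OF assms(1)] .
  consider "?ab = {} \<or> ?ba = {}" | w v w' v' where "(w, v) \<in> ?ab" "(w', v') \<in> ?ba"
    by fast
  then show ?thesis
  proof cases
    case 1
    then have "acyclic (?c \<union> (?ab \<union> ?ba))"
      using acyclic_precedence_crossing[OF assms(1) acyc] assms(2) sep by auto
    then show ?thesis using subset by (rule acyclic_subset)
  next
    case 2
    have ab: "f z = a \<and> t = b" if "(z, t) \<in> ?ab" for z t
      using opposite_crossing_footprint[OF assms(1,2) inj not_fixed that 2(2)] .
    have ba: "f z = b \<and> t = a" if "(z, t) \<in> ?ba" for z t
      using opposite_crossing_footprint[OF assms(1) sep inj _ that 2(1)] not_fixed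
      by (auto simp: insert_commute)
    have S: "z \<in> S" if "(z, t) \<in> ?ab \<union> ?ba" for z t using that by (auto simp: crossing_def)
    have "?ab \<subseteq> {(w, b)}" "?ba \<subseteq> {(w', a)}"
      using ab ba 2 S inj_onD[OF inj] by (metis UnCI insertCI subrelI)+
    then have "precedence (D \<union> {(a, b), (b, a)}) S f \<subseteq> insert (w', a) (insert (w, b) ?c)"
      using subset by blast
    moreover have "a \<noteq> b" using assms(2) by blast
    then have w: "w \<in> S" "f w = a" "w \<in> cnbhd D a" and w': "w' \<in> S" "f w' = b" "w' \<in> cnbhd D b"
      using 2 ab[OF 2(1)] ba[OF 2(2)] by (auto simp: crossing_def)
    moreover have "w \<noteq> a \<or> w' \<noteq> b" using not_fixed w w' by auto
    ultimately show ?thesis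
      using acyclic_precedence_insert_opposite[OF assms(1) acyc assms(2) sep]
      by (blast intro: acyclic_subset)
  qed
qed

section \<open>Forests\<close>

locale irreflexive_sym_rel =
  fixes E :: "('a \<times> 'a) set"
  assumes sym: "sym E" and irrefl: "(x, x) \<notin> E"
begin

lemma edge_sym: "(x, y) \<in> E \<Longrightarrow> (y, x) \<in> E"
  using sym by (rule symD)

end

locale forest_rel = irreflexive_sym_rel +
  assumes no_cycle: "simple_path E p \<Longrightarrow> (last p, hd p) \<in> E \<Longrightarrow> length p \<le> 2"
begin

lemma bridge:
  assumes "D \<subseteq> E" "(x, y) \<in> E" "(x, y) \<in> D\<^sup>*"
  shows "(x, y) \<in> D"
proof -
  obtain p where p: "simple_path D p" "hd p = x" "last p = y"
    using rtrancl_imp_simple_path[OF assms(3)] .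
  have "length p \<le> 2"
    using no_cycle simple_path_mono[OF p(1) assms(1)] edge_sym[OF assms(2)] p(2,3) by blast
  moreover have "p \<noteq> []" using p(1) by (simp add: simple_path_def)
  ultimately consider "p = [x]" "x = y" | "p = [x, y]"
    using p(2,3) by (cases p; cases "tl p") auto
  then show ?thesis
  proof cases
    case 1
    with assms(2) irrefl show ?thesis by blast
  next
    case 2
    with p(1) show ?thesis by (simp add: simple_path_def)
  qed
qed

theorem acyclic_precedence:
  assumes "finite E" and inj: "inj_on f S"
    and not_fixed: "\<And>u v. (u, v) \<in> E \<Longrightarrow> u \<in> S \<Longrightarrow> v \<in> S \<Longrightarrow> f ` {u, v} \<noteq> {u, v}"
  shows "acyclic (precedence E S f)"
proof -
  have "acyclic (precedence D S f)" if "finite D" "D \<subseteq> E" "sym D" for D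
    using that
  proof (induction D rule: finite_psubset_induct)
    case (psubset D)
    show ?case
    proof (cases "D = {}")
      case True
      then have "precedence D S f = {}" by (auto simp: precedence_def cnbhd_def)
      then show ?thesis by (simp add: acyclic_def)
    next
      case False
      then obtain a b where ab: "(a, b) \<in> D" by auto
      let ?D = "D - {(a, b), (b, a)}"
      have D: "?D \<subseteq> E" "sym ?D" using psubset.prems by (auto simp: sym_def)
      have E: "(a, b) \<in> E" using ab psubset.prems(1) by blast
      have "?D \<subset> D" using ab by blast
      with D have "acyclic (precedence ?D S f)" using psubset.IH by blast
      moreover have "(a, b) \<notin> ?D\<^sup>*" using bridge[OF D(1) E] by blast
      moreover have "?D \<union> {(a, b), (b, a)} = D" using ab psubset.prems(2) by (auto dest: symD)
      ultimately show ?thesis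
        using acyclic_precedence_insert_edge[OF D(2), of a b S f] inj not_fixed[OF E] by simp
    qed
  qed
  from this[OF assms(1) _ sym] show ?thesis by simp
qed

end

section \<open>Spines\<close>

definition leaf_in :: "('a \<times> 'a) set \<Rightarrow> 'a set \<Rightarrow> 'a \<Rightarrow> bool" where
  "leaf_in E C x \<longleftrightarrow> (\<exists>!y. y \<in> C \<and> (x, y) \<in> E)"

definition spine :: "('a \<times> 'a) set \<Rightarrow> 'a set \<Rightarrow> 'a list \<Rightarrow> bool" where
  "spine E C p \<longleftrightarrow> simple_path E p \<and> set p \<subseteq> C \<and> (\<forall>x\<in>C - set p. \<exists>y\<in>set p. (x, y) \<in> E)"

definition spine_partition :: "('a \<times> 'a) set \<Rightarrow> 'a set set \<Rightarrow> bool" where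
  "spine_partition E Q \<longleftrightarrow> partition_on (Domain E) Q \<and> (\<forall>C\<in>Q. \<exists>p. spine E C p) \<and>
    (\<forall>C\<in>Q. \<forall>D\<in>Q. C \<noteq> D \<longrightarrow>
      (\<forall>u\<in>C. \<forall>v\<in>D. (u, v) \<in> E \<longrightarrow> \<not> (leaf_in E C u \<and> leaf_in E D v)))"

lemma
  assumes "spine E C p"
  shows spine_simple_path: "simple_path E p" and spine_subset: "set p \<subseteq> C"
    and spine_nonempty: "p \<noteq> []" and spine_distinct: "distinct p"
    and spine_arcs: "set (vwalk_arcs p) \<subseteq> E"
  using assms by (simp_all add: spine_def simple_path_def)

lemma spine_Cons:
  assumes "spine E C p" "y \<in> C" "y \<notin> set p" "(y, hd p) \<in> E"
  shows "spine E C (y # p)"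
  using assms by (auto simp: spine_def simple_path_def)

context irreflexive_sym_rel
begin

lemma spine_rev: "spine E C p \<Longrightarrow> spine E C (rev p)"
  by (simp add: spine_def simple_path_rev[OF sym])

lemma leaf_in_imp_path_end:
  assumes "simple_path E p" "set p \<subseteq> C" "u \<in> set p" "leaf_in E C u"
  shows "u \<in> {hd p, last p}"
proof (rule ccontr)
  assume not_end: "u \<notin> {hd p, last p}"
  have "u \<in> set (tl p)" using not_end assms(3) by (cases p) auto
  then obtain x where x: "(x, u) \<in> set (vwalk_arcs p)"
    by (metis snd_set_vwalk_arcs imageE prod.collapse)
  have "u \<in> set (butlast p)" using not_end assms(3) by (cases p rule: rev_cases) auto
  then obtain y where y: "(u, y) \<in> set (vwalk_arcs p)"
    by (metis fst_set_vwalk_arcs imageE prod.collapse)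
  have "x \<in> C" "y \<in> C" "(u, x) \<in> E" "(u, y) \<in> E"
    using x y assms(1,2) edge_sym by (auto simp: simple_path_def dest: arcs_in_vwalk_arcs)
  then have "x = y" using assms(4) by (auto simp: leaf_in_def)
  with x y show False
    using vwalk_arcs_asym[of p x u] assms(1) by (simp add: simple_path_def)
qed

end

context forest_rel
begin

lemma off_spine_neighbour:
  assumes sp: "spine E C p" and x: "x \<in> C - set p"
  obtains a where "a \<in> set p" "\<And>y. y \<in> C \<and> (x, y) \<in> E \<longleftrightarrow> y = a"
proof -
  obtain a where a: "a \<in> set p" "(x, a) \<in> E" using sp x by (auto simp: spine_def)
  have "y = a" if y: "y \<in> C" "(x, y) \<in> E" for y
  proof (rule ccontr)
    assume "y \<noteq> a"
    let ?D = "E - {(x, y), (y, x)}"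
    obtain b where b: "b \<in> set p" "(b, y) \<in> ?D\<^sup>*"
    proof (cases "y \<in> set p")
      case False
      then obtain b where "b \<in> set p" "(y, b) \<in> E" using sp y(1) by (auto simp: spine_def)
      with x y False that[of b] edge_sym[of y b] show thesis by blast
    qed (use that in blast)
    have "set (vwalk_arcs p) \<subseteq> ?D"
      using spine_arcs[OF sp] x by (auto dest: arcs_in_vwalk_arcs)
    moreover have "sym ?D" using sym by (auto simp: sym_def)
    ultimately have "(a, b) \<in> ?D\<^sup>*" using vwalk_arcs_sym_rtrancl a(1) b(1) by metis
    moreover have "(x, a) \<in> ?D" using a x \<open>y \<noteq> a\<close> by blast
    ultimately have "(x, y) \<in> ?D\<^sup>*"
      using b(2) by (meson converse_rtrancl_into_rtrancl rtrancl_trans)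
    then show False using bridge[of ?D x y] y(2) by blast
  qed
  with a sp show thesis using that[of a] by (auto simp: spine_def)
qed

lemma off_spine_leaf_in:
  assumes "spine E C p" "x \<in> C - set p"
  shows "leaf_in E C x"
  using off_spine_neighbour[OF assms] unfolding leaf_in_def by metis

lemma path_neighbour_of_hd:
  assumes "simple_path E p" "w \<in> set p" "(hd p, w) \<in> E"
  shows "w = hd (tl p)"
proof -
  obtain p1 p2 where p: "p = p1 @ w # p2" using assms(2) by (meson split_list)
  have "p1 \<noteq> []" using assms(3) irrefl p by auto
  then have "simple_path E (p1 @ [w])"
    using assms(1) simple_path_append_iff[of "p1 @ [w]" p2 E] p by (cases "p2 = []") auto
  then have "length (p1 @ [w]) \<le> 2"
    using no_cycle[of "p1 @ [w]"] edge_sym[OF assms(3)] p \<open>p1 \<noteq> []\<close> by simp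
  with p \<open>p1 \<noteq> []\<close> show ?thesis by (cases p1) auto
qed

lemma maximal_spine_hd_leaf_in:
  assumes sp: "spine E C p" and max: "\<And>q. spine E C q \<Longrightarrow> length q \<le> length p" and "2 \<le> length p"
  shows "leaf_in E C (hd p)"
  unfolding leaf_in_def
proof (rule ex1I)
  have "tl p \<noteq> []" using assms(3) by (cases p) auto
  then have p: "p = hd p # hd (tl p) # tl (tl p)" using spine_nonempty[OF sp] by simp
  then have "(hd p, hd (tl p)) \<in> set (vwalk_arcs p)" "hd (tl p) \<in> set p"
    by (metis list.set_intros(1) vwalk_arcs.simps(3), metis list.set_intros)
  then show "hd (tl p) \<in> C \<and> (hd p, hd (tl p)) \<in> E"
    using spine_subset[OF sp] spine_arcs[OF sp] by blast
  show "w = hd (tl p)" if "w \<in> C \<and> (hd p, w) \<in> E" for w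
    using that spine_Cons[OF sp, of w] max[of "w # p"] edge_sym[of "hd p" w]
      path_neighbour_of_hd[OF spine_simple_path[OF sp]] by auto
qed

text \<open>The inner vertices of a path are not leaves. A maximal spine misses only leaves and ends in
  two leaves, so it has as many inner vertices as a path can have.\<close>

lemma maximal_spine_imp_longest_path:
  assumes sp: "spine E C p" and max: "\<And>q. spine E C q \<Longrightarrow> length q \<le> length p"
    and q: "simple_path E q" "set q \<subseteq> C"
  shows "length q \<le> length p"
proof (cases "2 \<le> length p")
  case True
  let ?inner = "\<lambda>p. set p - {hd p, last p}"
  have "leaf_in E C (hd p)" "leaf_in E C (last p)"
    using maximal_spine_hd_leaf_in[OF sp max True] maximal_spine_hd_leaf_in[OF spine_rev[OF sp]]
      max True by (simp_all add: hd_rev)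
  moreover have "u \<in> C \<and> \<not> leaf_in E C u" if "u \<in> ?inner q" for u
    using leaf_in_imp_path_end[OF q] q(2) that by blast
  ultimately have "?inner q \<subseteq> ?inner p" using off_spine_leaf_in[OF sp] by blast
  then have "card (?inner q) \<le> card (?inner p)" by (simp add: card_mono)
  moreover have "card (?inner p) = length p - 2"
  proof -
    have "hd p \<noteq> last p" using True spine_distinct[OF sp] by (cases p) auto
    then show ?thesis
      using spine_nonempty[OF sp] spine_distinct[OF sp]
      by (simp add: card_Diff_subset distinct_card)
  qed
  moreover have "length q - 2 \<le> card (?inner q)"
    using diff_card_le_card_Diff[of "{hd q, last q}" "set q"]
      card_insert_le_m1[of 2 "{last q}" "hd q"] q(1)
    by (simp add: simple_path_def distinct_card)
  ultimately show ?thesis using True by linarith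
next
  case False
  then obtain a where p: "p = [a]" using spine_nonempty[OF sp] by (cases p; cases "tl p") auto
  have "x = a" if "x \<in> C" for x
    using max[of "x # p"] spine_Cons[OF sp that] sp that by (auto simp: p spine_def)
  then have "set q \<subseteq> {a}" using q(2) by blast
  with q(1) show ?thesis
    using card_mono[of "{a}" "set q"] by (simp add: p simple_path_def distinct_card)
qed

lemma spine_imp_longest_spine:
  assumes "finite C" "spine E C p\<^sub>0"
  obtains p where "spine E C p" "\<And>q. simple_path E q \<Longrightarrow> set q \<subseteq> C \<Longrightarrow> length q \<le> length p"
proof -
  have "length q < Suc (card C)" if "spine E C q" for q
    using card_mono[OF assms(1) spine_subset[OF that]] distinct_card[OF spine_distinct[OF that]]
    by simp
  then obtain p where "spine E C p" "\<And>q. spine E C q \<Longrightarrow> length q \<le> length p"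
    using ex_has_greatest_nat[of "spine E C" p\<^sub>0 length] assms(2) by blast
  with that maximal_spine_imp_longest_path show thesis by blast
qed

end

section \<open>From spine partitions to footprint maps\<close>

lemma
  assumes "spine_partition E Q"
  shows spine_partition_Union: "\<Union>Q = Domain E"
    and spine_partition_eq: "C \<in> Q \<Longrightarrow> D \<in> Q \<Longrightarrow> x \<in> C \<Longrightarrow> x \<in> D \<Longrightarrow> C = D"
    and spine_partition_not_leaves:
      "C \<in> Q \<Longrightarrow> D \<in> Q \<Longrightarrow> C \<noteq> D \<Longrightarrow> u \<in> C \<Longrightarrow> v \<in> D \<Longrightarrow> (u, v) \<in> E \<Longrightarrow>
        leaf_in E C u \<Longrightarrow> leaf_in E D v \<Longrightarrow> False"
  using assms partition_onD1[of "Domain E" Q] partition_onD2[of "Domain E" Q]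
  by (auto simp: spine_partition_def disjoint_def)

lemma spine_partition_imp_path_cover:
  assumes Q: "spine_partition E Q"
  obtains sp where "\<And>C. C \<in> Q \<Longrightarrow> spine E C (sp C)" "path_cover E (\<Union>C\<in>Q. set (sp C)) (sp ` Q)"
    "card (last ` sp ` Q) = card Q"
proof -
  obtain sp where sp: "\<And>C. C \<in> Q \<Longrightarrow> spine E C (sp C)"
    using Q unfolding spine_partition_def by metis
  have "set (sp C) \<inter> set (sp D) = {}" if "C \<in> Q" "D \<in> Q" "sp C \<noteq> sp D" for C D
    using that spine_partition_eq[OF Q, of C D] spine_subset[OF sp] by blast
  then have "path_cover E (\<Union>C\<in>Q. set (sp C)) (sp ` Q)"
    using spine_simple_path[OF sp] by (auto simp: path_cover_def disjoint_family_on_def)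
  moreover have "inj_on (last \<circ> sp) Q"
  proof (rule inj_onI)
    fix C D assume CD: "C \<in> Q" "D \<in> Q" "(last \<circ> sp) C = (last \<circ> sp) D"
    have "last (sp C') \<in> C'" if "C' \<in> Q" for C'
      using spine_subset[OF sp[OF that]] spine_nonempty[OF sp[OF that]] last_in_set by blast
    with CD show "C = D" using spine_partition_eq[OF Q CD(1,2)] by (metis comp_apply)
  qed
  then have "card (last ` sp ` Q) = card Q" by (metis card_image image_comp)
  ultimately show thesis using that sp by blast
qed

context forest_rel
begin

lemma off_spine_not_adjacent:
  assumes Q: "spine_partition E Q" and sp: "\<And>C. C \<in> Q \<Longrightarrow> spine E C (sp C)"
    and uv: "u \<in> \<Union>Q - (\<Union>C\<in>Q. set (sp C))" "v \<in> \<Union>Q - (\<Union>C\<in>Q. set (sp C))"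
  shows "(u, v) \<notin> E"
proof
  assume E: "(u, v) \<in> E"
  obtain C D where C: "C \<in> Q" "u \<in> C - set (sp C)" and D: "D \<in> Q" "v \<in> D - set (sp D)"
    using uv by auto
  show False
  proof (cases "C = D")
    case True
    then show False using off_spine_neighbour[OF sp[OF C(1)] C(2)] D E by (metis DiffD1 DiffD2)
  next
    case False
    moreover have "leaf_in E C u" "leaf_in E D v"
      using off_spine_leaf_in[OF sp] C D by blast+
    ultimately show False using spine_partition_not_leaves[OF Q C(1) D(1)] C D E by blast
  qed
qed

theorem spine_partition_imp_footprint_map:
  assumes "finite V" "E \<subseteq> V \<times> V" and Q: "spine_partition E Q"
  obtains S f where "S \<subseteq> V" "footprint_map E S f" "card S + card Q = card V"
proof -
  obtain sp where sp: "\<And>C. C \<in> Q \<Longrightarrow> spine E C (sp C)"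
    and cover: "path_cover E (\<Union>C\<in>Q. set (sp C)) (sp ` Q)" and card: "card (last ` sp ` Q) = card Q"
    using spine_partition_imp_path_cover[OF Q] by blast
  let ?U = "\<Union>C\<in>Q. set (sp C)" and ?ends = "last ` sp ` Q" and ?S = "V - last ` sp ` Q"
  obtain f where moved: "\<And>x. f x \<noteq> x \<longleftrightarrow> x \<in> ?U - ?ends" and arc: "\<And>x. f x \<noteq> x \<Longrightarrow> (x, f x) \<in> E"
    and inj: "inj_on f (- ?ends)" and asym: "\<And>x. f x \<noteq> x \<Longrightarrow> f (f x) \<noteq> x"
    using path_cover_imp_successor[OF cover] by blast
  have not_fixed: "f ` {u, v} \<noteq> {u, v}" if uv: "(u, v) \<in> E" "u \<in> ?S" "v \<in> ?S" for u v
  proof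
    assume "f ` {u, v} = {u, v}"
    then consider "f u = v" "f v = u" | "f u = u" "f v = v" by (auto simp: doubleton_eq_iff)
    then show False
    proof cases
      case 1
      moreover have "u \<noteq> v" using uv(1) irrefl by blast
      ultimately show False using asym[of u] by simp
    next
      case 2
      then have "u \<notin> ?U" "v \<notin> ?U" using moved uv(2,3) by blast+
      moreover have "u \<in> \<Union>Q" "v \<in> \<Union>Q"
        using uv(1) edge_sym[OF uv(1)] spine_partition_Union[OF Q] by auto
      ultimately show False using off_spine_not_adjacent[OF Q sp] uv(1) by blast
    qed
  qed
  have "finite E" using assms(1,2) by (meson finite_SigmaI finite_subset)
  moreover have "inj_on f ?S" using inj by (rule inj_on_subset) blast
  ultimately have "acyclic (precedence E ?S f)" using not_fixed by (rule acyclic_precedence)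
  moreover have "f x \<in> cnbhd E x" for x using arc[of x] by (auto simp: mem_cnbhd_iff)
  ultimately have "footprint_map E ?S f" by (simp add: footprint_map_def)
  moreover have "card ?S + card Q = card V"
  proof -
    have "last (sp C) \<in> V" if "C \<in> Q" for C
      using spine_subset[OF sp[OF that]] spine_nonempty[OF sp[OF that]] spine_partition_Union[OF Q]
        assms(2) that last_in_set by blast
    then have ends: "?ends \<subseteq> V" by blast
    then show ?thesis
      using card card_mono[OF assms(1) ends] finite_subset[OF ends assms(1)]
      by (simp add: card_Diff_subset)
  qed
  ultimately show thesis using that by blast
qed

end

section \<open>From footprint maps to spine partitions\<close>

definition unjoinable :: "('a \<times> 'a) set \<Rightarrow> 'a list set \<Rightarrow> bool" where
  "unjoinable E \<P> \<longleftrightarrow>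
    (\<forall>p\<in>\<P>. \<forall>q\<in>\<P>. p \<noteq> q \<longrightarrow> {hd p, last p} \<times> {hd q, last q} \<inter> E = {})"

definition paths_outside :: "'a set \<Rightarrow> 'a list set \<Rightarrow> 'a list set" where
  "paths_outside I \<P> = {p \<in> \<P>. \<not> set p \<subseteq> I}"

lemma path_into_end:
  assumes "sym E" "simple_path E p" "u \<in> {hd p, last p}"
  obtains q where "simple_path E q" "set q = set p" "last q = u"
  using assms that[of p] that[of "rev p"] simple_path_rev[OF assms(1,2)]
  by (auto simp: simple_path_def last_rev)

lemma simple_path_join_ends:
  assumes "sym E" and p: "simple_path E p" "u \<in> {hd p, last p}"
    and q: "simple_path E q" "v \<in> {hd q, last q}" and "set p \<inter> set q = {}" "(u, v) \<in> E"
  obtains r where "simple_path E r" "set r = set p \<union> set q"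
proof -
  obtain p' where p': "simple_path E p'" "set p' = set p" "last p' = u"
    using path_into_end[OF assms(1) p] .
  obtain q' where q': "simple_path E q'" "set q' = set q" "last q' = v"
    using path_into_end[OF assms(1) q] .
  have "simple_path E (p' @ rev q')"
    using p' q' assms(6,7) simple_path_rev[OF assms(1) q'(1)]
    by (subst simple_path_append_iff) (auto simp: simple_path_def hd_rev)
  with p'(2) q'(2) that show thesis by simp
qed

lemma simple_path_in_independent:
  assumes "simple_path E p" "set p \<subseteq> I" "I \<times> I \<inter> E = {}" "x \<in> set p"
  shows "p = [x]"
  using assms by (cases p rule: vwalk_arcs.cases) (auto simp: simple_path_def)

lemma independent_path_cover_singleton:
  assumes indep: "I \<times> I \<inter> E = {}" and cover: "path_cover E W \<P>"
    and x: "x \<in> W - (\<Union>p\<in>paths_outside I \<P>. set p)"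
  shows "x \<in> I" "[x] \<in> \<P> - paths_outside I \<P>"
proof -
  obtain p where p: "p \<in> \<P> - paths_outside I \<P>" "x \<in> set p"
    using x path_cover_Union[OF cover] by blast
  then have I: "set p \<subseteq> I" by (auto simp: paths_outside_def)
  with p(2) show "x \<in> I" by blast
  have "simple_path E p" using path_cover_simple_path[OF cover] p(1) by blast
  then have "p = [x]" using simple_path_in_independent[OF _ I indep p(2)] by blast
  with p(1) show "[x] \<in> \<P> - paths_outside I \<P>" by simp
qed

definition footprint_arcs :: "'a set \<Rightarrow> ('a \<Rightarrow> 'a) \<Rightarrow> ('a \<times> 'a) set" where
  "footprint_arcs S f = (\<lambda>v. (v, f v)) ` {v \<in> S. f v \<noteq> v}"

definition attached :: "'a set \<Rightarrow> ('a \<Rightarrow> 'a list) \<Rightarrow> 'a list \<Rightarrow> 'a set" where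
  "attached R a p = set p \<union> {x \<in> R. a x = p}"

lemma partition_on_attached:
  assumes cover: "path_cover E W \<P>" and "\<C> \<subseteq> \<P>"
    and a: "\<And>x. x \<in> W - (\<Union>p\<in>\<C>. set p) \<Longrightarrow> a x \<in> \<C>"
  shows "partition_on W (attached (W - (\<Union>p\<in>\<C>. set p)) a ` \<C>)" (is "partition_on W (?part ` \<C>)")
proof (rule partition_onI)
  have "x \<in> \<Union>(?part ` \<C>)" if "x \<in> W" for x
    using that a[of x] by (cases "x \<in> (\<Union>p\<in>\<C>. set p)") (auto simp: attached_def)
  moreover have "?part p \<subseteq> W" if "p \<in> \<C>" for p
    using path_cover_Union[OF cover] assms(2) that by (auto simp: attached_def)
  ultimately show "\<Union>(?part ` \<C>) = W" by blast
  have "p = q" if "p \<in> \<C>" "q \<in> \<C>" "x \<in> ?part p" "x \<in> ?part q" for p q x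
    using that path_cover_eq[OF cover, of p q x] assms(2) by (auto simp: attached_def)
  then show "disjnt C D" if "C \<in> ?part ` \<C>" "D \<in> ?part ` \<C>" "C \<noteq> D" for C D
    using that by (auto simp: disjnt_iff)
  show "{} \<notin> ?part ` \<C>" using path_cover_nonempty[OF cover] assms(2) by (auto simp: attached_def)
qed

lemma card_paths_outside_le:
  assumes cover: "path_cover A W \<P>" and "finite W" "J \<subseteq> W \<inter> I" "J \<inter> Field A = {}"
  shows "card (paths_outside I \<P>) + card J \<le> card \<P>"
proof -
  have fin: "finite \<P>" using finite_path_cover[OF cover assms(2)] .
  have single: "[x] \<in> \<P>" if x: "x \<in> J" for x
  proof -
    obtain p where p: "p \<in> \<P>" "x \<in> set p" using x assms(3) path_cover_Union[OF cover] by blast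
    have "x \<notin> Domain A" "x \<notin> Range A" using x assms(4) by (auto simp: Field_def)
    then have "x \<notin> set (butlast p)" "x \<notin> set (tl p)"
      using simple_path_butlast_Domain simple_path_tl_Range path_cover_simple_path[OF cover p(1)]
      by blast+
    then have "p = [x]" using p(2) by (cases p; cases "tl p") auto
    with p(1) show ?thesis by simp
  qed
  have "card J = card ((\<lambda>x. [x]) ` J)" by (simp add: card_image inj_on_def)
  also have "card (paths_outside I \<P>) + \<dots> = card (paths_outside I \<P> \<union> (\<lambda>x. [x]) ` J)"
    using fin finite_subset[OF assms(3)] assms(2,3)
    by (subst card_Un_disjoint) (auto simp: paths_outside_def)
  also have "\<dots> \<le> card \<P>"
    using single fin by (intro card_mono) (auto simp: paths_outside_def)
  finally show ?thesis .
qed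

context irreflexive_sym_rel
begin

lemma not_unjoinable_imp_fewer_paths:
  assumes "finite W" and indep: "I \<times> I \<inter> E = {}" and cover: "path_cover E W \<P>"
    and "\<not> unjoinable E \<P>"
  obtains \<Q> where "path_cover E W \<Q>" "card \<Q> < card \<P>"
    "card (paths_outside I \<Q>) \<le> card (paths_outside I \<P>)"
proof -
  obtain p q u v where pq: "p \<in> \<P>" "q \<in> \<P>" "p \<noteq> q"
    and uv: "u \<in> {hd p, last p}" "v \<in> {hd q, last q}" "(u, v) \<in> E"
    using assms(4) unfolding unjoinable_def by blast
  have "set p \<inter> set q = {}" using path_cover_eq[OF cover pq(1,2)] pq(3) by blast
  then obtain r where r: "simple_path E r" "set r = set p \<union> set q"
    using simple_path_join_ends[OF sym path_cover_simple_path[OF cover pq(1)] uv(1)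
        path_cover_simple_path[OF cover pq(2)] uv(2) _ uv(3)] by blast
  let ?\<Q> = "insert r (\<P> - {p, q})"
  have fin: "finite (paths_outside I \<P>)"
    using finite_path_cover[OF cover assms(1)] by (simp add: paths_outside_def)
  have "u \<in> set p" "v \<in> set q" using uv path_cover_nonempty[OF cover] pq by auto
  then obtain s where s: "s \<in> {p, q}" "s \<in> paths_outside I \<P>"
    using indep uv(3) pq unfolding paths_outside_def by blast
  then have "paths_outside I ?\<Q> \<subseteq> insert r (paths_outside I \<P> - {s})"
    by (auto simp: paths_outside_def)
  then have "card (paths_outside I ?\<Q>) \<le> card (insert r (paths_outside I \<P> - {s}))"
    using fin by (intro card_mono) auto
  also have "\<dots> \<le> card (paths_outside I \<P>)"
    using card.remove[OF fin s(2)] fin by (simp add: card_insert_if)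
  finally show thesis using that[of ?\<Q>] path_cover_join[OF cover assms(1) pq r] by simp
qed

lemma path_cover_imp_unjoinable_path_cover:
  assumes "finite W" "I \<times> I \<inter> E = {}" "path_cover E W \<P>"
  obtains \<Q> where "path_cover E W \<Q>" "unjoinable E \<Q>"
    "card (paths_outside I \<Q>) \<le> card (paths_outside I \<P>)"
proof -
  have "\<exists>\<Q>. path_cover E W \<Q> \<and> unjoinable E \<Q> \<and>
      card (paths_outside I \<Q>) \<le> card (paths_outside I \<P>)"
    using assms(3)
  proof (induction "card \<P>" arbitrary: \<P> rule: less_induct)
    case less
    show ?case
    proof (cases "unjoinable E \<P>")
      case False
      then obtain \<Q> where "path_cover E W \<Q>" "card \<Q> < card \<P>"
        "card (paths_outside I \<Q>) \<le> card (paths_outside I \<P>)"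
        using not_unjoinable_imp_fewer_paths[OF assms(1,2) less.prems] by blast
      then show ?thesis using less.hyps le_trans by blast
    qed (use less.prems in blast)
  qed
  with that show thesis by blast
qed

lemma leaf_in_attached_imp_path_end:
  assumes p: "simple_path E p" "p \<in> \<C>" "\<C> \<subseteq> \<P>" and R: "\<And>x. x \<in> R \<Longrightarrow> [x] \<in> \<P> - \<C>"
    and u: "u \<in> attached R a p" "leaf_in E (attached R a p) u"
  obtains q where "q \<in> \<P>" "u \<in> {hd q, last q}" "q = p \<or> q = [u] \<and> q \<notin> \<C>"
proof (cases "u \<in> set p")
  case True
  have "set p \<subseteq> attached R a p" by (simp add: attached_def)
  from leaf_in_imp_path_end[OF p(1) this True u(2)] show thesis using that[of p] p(2,3) by blast
next
  case False
  then have "u \<in> R" using u(1) by (simp add: attached_def)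
  with R[of u] that[of "[u]"] show thesis by simp
qed

lemma unjoinable_path_cover_imp_spine_partition:
  assumes "finite (Domain E)" and indep: "I \<times> I \<inter> E = {}"
    and cover: "path_cover E (Domain E) \<P>" and unj: "unjoinable E \<P>"
  obtains Q where "spine_partition E Q" "card Q \<le> card (paths_outside I \<P>)"
proof -
  let ?\<C> = "paths_outside I \<P>"
  let ?R = "Domain E - (\<Union>p\<in>?\<C>. set p)"
  note single = independent_path_cover_singleton[OF indep cover]
  have "\<exists>p\<in>?\<C>. \<exists>y\<in>set p. (x, y) \<in> E" if x: "x \<in> ?R" for x
  proof -
    obtain y where y: "(x, y) \<in> E" using x by blast
    have "y \<notin> I" using single(1)[OF x] y indep by blast
    then have "y \<notin> ?R" using single(1)[of y] by meson
    moreover have "y \<in> Domain E" using edge_sym[OF y] by blast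
    ultimately show ?thesis using y by blast
  qed
  then obtain a where a: "\<And>x. x \<in> ?R \<Longrightarrow> a x \<in> ?\<C> \<and> (\<exists>y\<in>set (a x). (x, y) \<in> E)"
    by metis
  let ?part = "attached ?R a"
  have \<C>: "?\<C> \<subseteq> \<P>" by (auto simp: paths_outside_def)
  note path = path_cover_simple_path[OF cover subsetD[OF \<C>]]
  have spine: "spine E (?part p) p" if "p \<in> ?\<C>" for p
    using path[OF that] a by (auto simp: spine_def attached_def)
  have "partition_on (Domain E) (?part ` ?\<C>)"
    using a by (intro partition_on_attached[OF cover \<C>]) blast+
  moreover have "\<not> (leaf_in E (?part p) u \<and> leaf_in E (?part q) v)"
    if pq: "p \<in> ?\<C>" "q \<in> ?\<C>" "p \<noteq> q" and uv: "u \<in> ?part p" "v \<in> ?part q" "(u, v) \<in> E"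
    for p q u v
  proof
    assume leaf: "leaf_in E (?part p) u \<and> leaf_in E (?part q) v"
    obtain p' where p': "p' \<in> \<P>" "u \<in> {hd p', last p'}" "p' = p \<or> p' = [u] \<and> p' \<notin> ?\<C>"
      using leaf_in_attached_imp_path_end[OF path[OF pq(1)] pq(1) \<C> single(2) uv(1)] leaf by blast
    obtain q' where q': "q' \<in> \<P>" "v \<in> {hd q', last q'}" "q' = q \<or> q' = [v] \<and> q' \<notin> ?\<C>"
      using leaf_in_attached_imp_path_end[OF path[OF pq(2)] pq(2) \<C> single(2) uv(2)] leaf by blast
    have "p' \<noteq> q'" using p'(3) q'(3) pq uv(3) irrefl by auto
    with unj p' q' uv(3) show False unfolding unjoinable_def by blast
  qed
  ultimately have "spine_partition E (?part ` ?\<C>)"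
    unfolding spine_partition_def using spine by (auto; metis)
  moreover have "card (?part ` ?\<C>) \<le> card ?\<C>"
    using finite_path_cover[OF cover assms(1)] finite_subset[OF \<C>] by (intro card_image_le) blast
  ultimately show thesis using that by blast
qed

lemma footprint_arcs_path_cover:
  assumes "finite (Domain E)" and f: "footprint_map E S f"
  obtains \<P> where "path_cover (footprint_arcs S f) (Domain E) \<P>" "footprint_arcs S f \<subseteq> E"
    "card \<P> + card {v \<in> S. f v \<noteq> v} = card (Domain E)"
proof -
  let ?A = "footprint_arcs S f"
  have E: "?A \<subseteq> E" using f by (auto simp: footprint_arcs_def footprint_map_def mem_cnbhd_iff)
  then have W: "?A \<subseteq> Domain E \<times> Domain E" using edge_sym by auto
  have "?A \<subseteq> precedence E S f"
    using f edge_sym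
    by (auto simp: footprint_arcs_def footprint_map_def precedence_def mem_cnbhd_iff)
  then have "acyclic ?A" using f by (auto simp: footprint_map_def intro: acyclic_subset)
  moreover have "single_valued ?A" by (auto simp: footprint_arcs_def single_valued_def)
  moreover have "single_valued (?A\<inverse>)"
    using footprint_map_inj_on[OF f] by (auto simp: footprint_arcs_def single_valued_def inj_on_def)
  ultimately obtain \<P> where "path_cover ?A (Domain E) \<P>" "card \<P> + card ?A = card (Domain E)"
    using acyclic_linear_imp_path_cover[OF assms(1) W] by blast
  moreover have "card ?A = card {v \<in> S. f v \<noteq> v}"
    unfolding footprint_arcs_def by (intro card_image) (simp add: inj_on_def)
  ultimately show thesis using that E by simp
qed

lemma footprint_map_imp_path_cover:
  assumes "finite V" "E \<subseteq> V \<times> V" "S \<subseteq> V" and f: "footprint_map E S f"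
  obtains \<P> where "path_cover E (Domain E) \<P>"
    "card (paths_outside {v \<in> S. f v = v} \<P>) + card S \<le> card V"
proof -
  let ?I = "{v \<in> S. f v = v}" and ?M = "{v \<in> S. f v \<noteq> v}" and ?W = "Domain E"
  have W: "?W \<subseteq> V" "finite ?W" using assms(1,2) finite_subset[of ?W V] by auto
  have fin: "finite S" using assms(1,3) finite_subset by blast
  obtain \<P> where \<P>: "path_cover (footprint_arcs S f) ?W \<P>" "card \<P> + card ?M = card ?W"
    and E: "footprint_arcs S f \<subseteq> E"
    using footprint_arcs_path_cover[OF W(2) f] by blast
  have "?I \<inter> Field (footprint_arcs S f) = {}"
    using footprint_map_inj_on[OF f] by (auto simp: footprint_arcs_def Field_def inj_on_def)
  then have "card (paths_outside ?I \<P>) + card (?I \<inter> ?W) \<le> card \<P>"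
    by (intro card_paths_outside_le[OF \<P>(1) W(2)]) auto
  moreover have "card S = card ?I + card ?M"
    using fin by (subst card_Un_disjoint[symmetric]) (auto intro: arg_cong[of _ _ card])
  moreover have "card ?I + card ?W = card (?I \<union> ?W) + card (?I \<inter> ?W)"
    using fin W(2) by (intro card_Un_Int) simp_all
  moreover have "card (?I \<union> ?W) \<le> card V" using assms(1,3) W(1) by (intro card_mono) auto
  ultimately have "card (paths_outside ?I \<P>) + card S \<le> card V" using \<P>(2) by linarith
  with that path_cover_mono[OF \<P>(1) E] show thesis by blast
qed

theorem footprint_map_imp_spine_partition:
  assumes "finite V" "E \<subseteq> V \<times> V" "S \<subseteq> V" and f: "footprint_map E S f"
  obtains Q where "spine_partition E Q" "card Q + card S \<le> card V"
proof -
  let ?I = "{v \<in> S. f v = v}"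
  have indep: "?I \<times> ?I \<inter> E = {}" using footprint_map_fixed_not_adjacent[OF f sym] irrefl by blast
  have fin: "finite (Domain E)" using assms(1,2) finite_subset[of "Domain E" V] by auto
  obtain \<P> where "path_cover E (Domain E) \<P>" "card (paths_outside ?I \<P>) + card S \<le> card V"
    using footprint_map_imp_path_cover[OF assms] .
  moreover from path_cover_imp_unjoinable_path_cover[OF fin indep this(1)]
  obtain \<Q> where "path_cover E (Domain E) \<Q>" "unjoinable E \<Q>"
    "card (paths_outside ?I \<Q>) \<le> card (paths_outside ?I \<P>)" by blast
  moreover from unjoinable_path_cover_imp_spine_partition[OF fin indep this(1,2)]
  obtain Q where "spine_partition E Q" "card Q \<le> card (paths_outside ?I \<Q>)" by blast
  ultimately show thesis using that by (meson add_le_mono1 le_trans)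
qed

end

section \<open>Translation to the graph library\<close>

lemma vpath_iff_simple_path: "vpath p G \<longleftrightarrow> simple_path (arcs_ends G) p \<and> set p \<subseteq> verts G"
  by (auto simp: vpath_def vwalk_def simple_path_def)

lemma arcs_ends_induce: "arcs_ends (G \<restriction> C) = arcs_ends G \<inter> C \<times> C"
  by (auto simp: arcs_ends_conv)

lemma vpath_induce_iff: "vpath p (G \<restriction> C) \<longleftrightarrow> simple_path (arcs_ends G) p \<and> set p \<subseteq> C"
  by (auto simp: vpath_iff_simple_path arcs_ends_induce simple_path_def dest: arcs_in_vwalk_arcs)

context wf_digraph
begin

lemma vwalk_imp_awalk:
  assumes "vwalk p G"
  obtains es where "awalk (hd p) es (last p)" "awalk_verts (hd p) es = p"
proof -
  from assms have "\<exists>es. awalk (hd p) es (last p) \<and> awalk_verts (hd p) es = p"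
  proof (induction rule: vwalk_induct)
    case (Base u)
    then show ?case by (intro exI[of _ "[]"]) (simp add: awalk_Nil_iff)
  next
    case (Cons u v p)
    then obtain es where es: "awalk v es (last (v # p))" "awalk_verts v es = v # p" by auto
    obtain e where "e \<in> arcs G" "tail G e = u" "head G e = v"
      using Cons.hyps by blast
    with es show ?case by (intro exI[of _ "e # es"]) (auto simp: awalk_Cons_iff)
  qed
  with that show thesis by blast
qed

lemma vpath_closing_arc_imp_cycle:
  assumes "vpath p G" "last p \<rightarrow> hd p"
  obtains es where "cycle es" "length es = length p"
proof -
  have p: "vwalk p G" "distinct p" "p \<noteq> []" using assms(1) by auto
  have "vwalk (last p # p) G" using vwalk_wf_digraph_consI[OF p(1) assms(2)] .
  then obtain es where es: "awalk (last p) es (last p)" "awalk_verts (last p) es = last p # p"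
    using vwalk_imp_awalk[of "last p # p"] p(3) by auto
  then have "length es = length p" using length_awalk_verts[of "last p" es] by simp
  moreover from this have "cycle es" using es p(2,3) by (auto simp: cycle_def)
  ultimately show thesis using that by blast
qed

lemma graph_dist_le_1_iff:
  assumes "u \<in> verts G"
  shows "graph_dist G u v \<le> 1 \<longleftrightarrow> u = v \<or> u \<rightarrow> v"
proof -
  have cost: "awalk_cost (\<lambda>_. 1) p = real (length p)" for p
    by (induction p) auto
  show ?thesis
  proof
    assume "graph_dist G u v \<le> 1"
    then have "\<mu> (\<lambda>_. 1) u v < 2"
      unfolding graph_dist_def by (rule le_less_trans) simp
    then obtain p where p: "awalk u p v" "ereal (awalk_cost (\<lambda>_. 1) p) < 2"
      unfolding \<mu>_def by (auto simp: INF_less_iff)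
    then consider "p = []" | e where "p = [e]"
      by (cases p; cases "tl p") (auto simp: cost)
    then show "u = v \<or> u \<rightarrow> v"
      using p(1) by cases (auto simp: awalk_Nil_iff awalk_Cons_iff arcs_ends_conv)
  next
    assume "u = v \<or> u \<rightarrow> v"
    then obtain p where "awalk u p v" "length p \<le> 1"
      using assms that[of "[]"] that[of "[_]"]
      by (force simp: awalk_Nil_iff intro: arc_implies_awalk)
    then show "graph_dist G u v \<le> 1"
      unfolding graph_dist_def
      by (intro order_trans[OF min_cost_le_walk_cost]) (auto simp: cost)
  qed
qed

end

lemma undirected_forest_imp_forest_rel:
  assumes "undirected_forest F"
  shows "forest_rel (arcs_ends F)"
proof -
  interpret graph F using assms by (simp add: undirected_forest_def)
  show ?thesis
  proof
    show "sym (arcs_ends F)" using sym_arcs by (simp add: symmetric_def)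
    show "(x, x) \<notin> arcs_ends F" for x using adj_not_same by blast
    show "length p \<le> 2" if p: "simple_path (arcs_ends F) p" "last p \<rightarrow>\<^bsub>F\<^esub> hd p" for p
    proof (rule ccontr)
      have "set (tl p) \<subseteq> verts F" using simple_path_tl_Range[OF p(1)] adj_in_verts by blast
      then have "set p \<subseteq> verts F" using p(2) adj_in_verts by (cases p) auto
      then have "vpath p F" using p(1) by (simp add: vpath_iff_simple_path)
      then obtain es where "cycle es" "length es = length p"
        using vpath_closing_arc_imp_cycle p(2) by blast
      moreover assume "\<not> length p \<le> 2"
      ultimately show False using assms by (force simp: undirected_forest_def)
    qed
  qed
qed

lemma undirected_forest_induce:
  assumes "undirected_forest F" "C \<subseteq> verts F"
  shows "undirected_forest (F \<restriction> C)"
proof -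
  interpret graph F using assms by (simp add: undirected_forest_def)
  have "finite C" using assms(2) finite_verts finite_subset by blast
  moreover have "symmetric (F \<restriction> C)"
    using sym_arcs by (auto simp: symmetric_def arcs_ends_induce sym_def)
  ultimately have "graph (F \<restriction> C)"
    by unfold_locales (use no_loops no_multi_arcs in auto)
  moreover have "pre_digraph.cycle F p" if "pre_digraph.cycle (F \<restriction> C) p" for p
    using subgraph_cycle[OF induced_imp_subgraph[OF induced_induce[OF assms(2)]] that] .
  ultimately show ?thesis using assms(1) by (auto simp: undirected_forest_def)
qed

lemma spine_imp_connected_induce:
  assumes "graph F" "C \<subseteq> verts F" and sp: "spine (arcs_ends F) C p"
  shows "connected (F \<restriction> C)"
proof -
  interpret graph F by fact
  interpret H: wf_digraph "F \<restriction> C" by (rule wellformed_induce_subgraph)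
  let ?H = "arcs_ends (F \<restriction> C)"
  have sym: "sym ?H" using sym_arcs by (auto simp: symmetric_def arcs_ends_induce sym_def)
  have p: "set (vwalk_arcs p) \<subseteq> ?H"
    using spine_subset[OF sp] spine_arcs[OF sp]
    by (auto simp: arcs_ends_induce dest: arcs_in_vwalk_arcs)
  have to_spine: "\<exists>u\<in>set p. (x, u) \<in> ?H\<^sup>*" if x: "x \<in> C" for x
  proof (cases "x \<in> set p")
    case False
    then obtain u where "u \<in> set p" "(x, u) \<in> arcs_ends F" using sp x by (auto simp: spine_def)
    with x spine_subset[OF sp] show ?thesis by (auto simp: arcs_ends_induce)
  qed blast
  have "x \<rightarrow>\<^sup>*\<^bsub>F \<restriction> C\<^esub> y" if xy: "x \<in> C" "y \<in> C" for x y
  proof -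
    obtain u v where "u \<in> set p" "(x, u) \<in> ?H\<^sup>*" "v \<in> set p" "(y, v) \<in> ?H\<^sup>*"
      using to_spine xy by blast
    then have "(x, y) \<in> ?H\<^sup>*"
      using vwalk_arcs_sym_rtrancl[OF sym p] symD[OF sym_rtrancl[OF sym]] by (meson rtrancl_trans)
    then show ?thesis
      using xy by (auto simp: rtrancl_eq_or_trancl intro: H.reachable1_reachable)
  qed
  moreover have "C \<noteq> {}" using spine_subset[OF sp] spine_nonempty[OF sp] by auto
  ultimately show ?thesis
    by (intro H.connectedI) (auto intro: H.reachable_mk_symmetricI)
qed

lemma caterpillar_iff_spine:
  assumes F: "undirected_forest F" and C: "C \<subseteq> verts F"
  shows "caterpillar (F \<restriction> C) \<longleftrightarrow> (\<exists>p. spine (arcs_ends F) C p)"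
proof -
  interpret forest_rel "arcs_ends F" using undirected_forest_imp_forest_rel[OF F] .
  have forest: "undirected_forest (F \<restriction> C)" using undirected_forest_induce[OF F C] .
  then interpret H: graph "F \<restriction> C" by (simp add: undirected_forest_def)
  have near: "graph_dist (F \<restriction> C) x y \<le> 1 \<longleftrightarrow> x = y \<or> (x, y) \<in> arcs_ends F"
    if "x \<in> C" "y \<in> C" for x y
    using H.graph_dist_le_1_iff[of x y] that by (auto simp: arcs_ends_induce)
  have spine_iff: "spine (arcs_ends F) C p \<longleftrightarrow>
      vpath p (F \<restriction> C) \<and> (\<forall>v\<in>C. \<exists>u\<in>set p. graph_dist (F \<restriction> C) v u \<le> 1)" for p
  proof (cases "set p \<subseteq> C")
    case True
    have "(\<exists>u\<in>set p. graph_dist (F \<restriction> C) v u \<le> 1) \<longleftrightarrow> v \<in> set p \<or> (\<exists>u\<in>set p. (v, u) \<in> arcs_ends F)"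
      if "v \<in> C" for v
      using near[OF that] True by (metis subsetD)
    with True show ?thesis by (auto simp: spine_def vpath_induce_iff)
  qed (simp add: spine_def vpath_induce_iff)
  show ?thesis
  proof
    assume "caterpillar (F \<restriction> C)"
    then show "\<exists>p. spine (arcs_ends F) C p"
      by (auto simp: caterpillar_def longest_path_def spine_iff)
  next
    assume "\<exists>p. spine (arcs_ends F) C p"
    then obtain p where p: "spine (arcs_ends F) C p"
      and longest: "\<And>q. simple_path (arcs_ends F) q \<Longrightarrow> set q \<subseteq> C \<Longrightarrow> length q \<le> length p"
      using spine_imp_longest_spine H.finite_verts by (metis induce_subgraph_verts)
    have "longest_path (F \<restriction> C) p"
      using p longest
      by (auto simp: longest_path_def spine_iff vpath_induce_iff intro: diff_le_mono)
    moreover have "connected (F \<restriction> C)"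
      using spine_imp_connected_induce[OF _ C p] F by (simp add: undirected_forest_def)
    ultimately show "caterpillar (F \<restriction> C)"
      using forest p by (auto simp: caterpillar_def undirected_tree_def spine_iff)
  qed
qed

lemma non_leaf_induce_iff:
  assumes "graph F" "u \<in> C"
  shows "non_leaf (F \<restriction> C) u \<longleftrightarrow> \<not> leaf_in (arcs_ends F) C u"
proof -
  interpret graph F by fact
  have "inj_on (head F) (out_arcs (F \<restriction> C) u)"
    using no_multi_arcs by (auto simp: inj_on_def out_arcs_def arc_to_ends_def)
  moreover have "head F ` out_arcs (F \<restriction> C) u = {y \<in> C. u \<rightarrow>\<^bsub>F\<^esub> y}"
    using assms(2) by (auto simp: out_arcs_def arcs_ends_conv image_iff)
  ultimately have "out_degree (F \<restriction> C) u = card {y \<in> C. u \<rightarrow>\<^bsub>F\<^esub> y}"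
    unfolding out_degree_def by (metis card_image)
  moreover have "card {y \<in> C. u \<rightarrow>\<^bsub>F\<^esub> y} = 1 \<longleftrightarrow> leaf_in (arcs_ends F) C u"
    unfolding leaf_in_def One_nat_def card_1_singleton_iff by (auto simp: set_eq_iff) metis+
  ultimately show ?thesis using assms(2) by (simp add: non_leaf_def)
qed

lemma caterpillar_partition_iff_spine_partition:
  assumes F: "undirected_forest F"
  shows "caterpillar_partition F Q \<longleftrightarrow> spine_partition (arcs_ends F) Q"
proof -
  interpret graph F using F by (simp add: undirected_forest_def)
  have W: "non_isolated_verts F = Domain (arcs_ends F)"
    using adj_in_verts by (auto simp: non_isolated_verts_def)
  show ?thesis
  proof (cases "partition_on (Domain (arcs_ends F)) Q")
    case True
    then have "C \<subseteq> verts F" if "C \<in> Q" for C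
      using partition_onD1[OF True] that adj_in_verts by blast
    then have "(\<forall>C\<in>Q. caterpillar (F \<restriction> C)) \<longleftrightarrow> (\<forall>C\<in>Q. \<exists>p. spine (arcs_ends F) C p)"
      using caterpillar_iff_spine[OF F] by simp
    then show ?thesis
      using True non_leaf_induce_iff[OF graph_axioms]
      by (simp add: caterpillar_partition_def spine_partition_def W cong: ball_cong)
  qed (simp add: caterpillar_partition_def spine_partition_def W)
qed

lemma grundy_domination_number_eqI:
  assumes "legal_sequence G vs" "\<And>ws. legal_sequence G ws \<Longrightarrow> length ws \<le> length vs"
  shows "grundy_domination_number G = length vs"
  unfolding grundy_domination_number_def
proof (rule Max_eqI)
  show "finite {length ws | ws. legal_sequence G ws}"
    by (rule finite_subset[of _ "{..length vs}"]) (use assms(2) in auto)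
qed (use assms in auto)

theorem caterpillar_partition_imp_legal_sequence:
  assumes "undirected_forest F" "caterpillar_partition F P"
  obtains vs where "legal_sequence F vs" "length vs + card P = card (verts F)"
proof -
  interpret graph F using assms(1) by (simp add: undirected_forest_def)
  interpret forest_rel "arcs_ends F" using undirected_forest_imp_forest_rel[OF assms(1)] .
  have E: "arcs_ends F \<subseteq> verts F \<times> verts F" using adj_in_verts by auto
  have "spine_partition (arcs_ends F) P"
    using assms caterpillar_partition_iff_spine_partition by blast
  then obtain S f where S: "S \<subseteq> verts F" "footprint_map (arcs_ends F) S f"
    "card S + card P = card (verts F)"
    using spine_partition_imp_footprint_map[OF finite_verts E] by blast
  obtain vs where "legal_sequence F vs" "length vs = card S"
    using footprint_map_imp_legal_sequence[OF finite_subset[OF S(1) finite_verts] S(1,2)] .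
  with S(3) that show thesis by simp
qed

theorem legal_sequence_imp_caterpillar_partition:
  assumes "undirected_forest F" "legal_sequence F vs"
  obtains Q where "caterpillar_partition F Q" "length vs + card Q \<le> card (verts F)"
proof -
  interpret graph F using assms(1) by (simp add: undirected_forest_def)
  interpret forest_rel "arcs_ends F" using undirected_forest_imp_forest_rel[OF assms(1)] .
  have E: "arcs_ends F \<subseteq> verts F \<times> verts F" using adj_in_verts by auto
  obtain f where f: "footprint_map (arcs_ends F) (set vs) f" and "distinct vs"
    using legal_sequence_imp_footprint_map[OF assms(2)] .
  moreover have "set vs \<subseteq> verts F" using assms(2) by (simp add: legal_sequence_def)
  then obtain Q where Q: "spine_partition (arcs_ends F) Q"
    "card Q + card (set vs) \<le> card (verts F)"
    using footprint_map_imp_spine_partition[OF finite_verts E _ f] by blast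
  moreover have "caterpillar_partition F Q"
    using caterpillar_partition_iff_spine_partition[OF assms(1)] Q(1) by blast
  ultimately show thesis using that by (simp add: distinct_card)
qed

theorem theorem3p9:
  fixes F :: "('a,'b) pre_digraph" and P :: "'a set set"
  assumes "undirected_forest F"
    and "minimum_caterpillar_partition F P"
  shows "int (grundy_domination_number F) = int (card (verts F)) - int (card P)"
proof -
  have P: "caterpillar_partition F P"
    and minimum: "\<And>Q. caterpillar_partition F Q \<Longrightarrow> card P \<le> card Q"
    using assms(2) by (auto simp: minimum_caterpillar_partition_def)
  obtain vs where vs: "legal_sequence F vs" "length vs + card P = card (verts F)"
    using caterpillar_partition_imp_legal_sequence[OF assms(1) P] .
  have "length ws \<le> length vs" if ws: "legal_sequence F ws" for ws
  proof -
    obtain Q where "caterpillar_partition F Q" "length ws + card Q \<le> card (verts F)"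
      using legal_sequence_imp_caterpillar_partition[OF assms(1) ws] .
    with minimum[of Q] vs(2) show ?thesis by linarith
  qed
  with vs(1) have "grundy_domination_number F = length vs" by (rule grundy_domination_number_eqI)
  with vs(2) show ?thesis by linarith
qed

end
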